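(* Let $T=(V,E)$ be a finite tree with at least one edge. Let $\widetilde w$ and $\widetilde v$ be two solutions on $[0,\infty)$ of the unnormalized flow $\dot{\widetilde w}_e=-\kappa_e(\widetilde w)\widetilde w_e$ with positive initial metrics, and let $w=\widetilde w/\sum_f\widetilde w_f$ and $v=\widetilde v/\sum_f\widetilde v_f$ be their normalizations. For every $e\in E$, the limit $$r_e:=\lim_{t\to\infty}\frac{\widetilde v_e(t)}{\widetilde w_e(t)}$$ exists and belongs to $(0,\infty)$. For $p\in\overline\Delta_E$, define $$T_r(p)_e:=\frac{r_ep_e}{\sum_{f\in E}r_fp_f}.$$ Then $$\|v(t)-T_r(w(t))\|\longrightarrow0\quad(t\to\infty)\qquad\text{and}\qquad \omega(v)=T_r(\omega(w)).$$ The map $T_r$ is a homeomorphism of $\overline\Delta_E$, with inverse $T_{r^{-1}}$, where $(r^{-1})_e=r_e^{-1}$. Consequently, $$\{E^+(p):p\in\omega(w)\}=\{E^+(q):q\in\omega(v)\},$$ and $w$ converges (as $t\to\infty$) if and only if $v$ converges. If $w(t)\to p$, then $v(t)\to T_r(p)$.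
   Context: $T=(V,E)$ is a finite tree with at least one edge; $d_x$ is the combinatorial degree of $x\in V$. A positive metric is $w=(w_e)_{e\in E}$ with all $w_e>0$; it induces the path metric $d_w$ on $V$. Put $D_x(w)=\sum_{e\ni x}1/w_e$. For $\alpha\in[0,1)$ let $m_x^\alpha(x)=\alpha$ and $m_x^\alpha(z)=(1-\alpha)\,w_{xz}^{-1}/D_x(w)$ for $z\sim x$. The (inverse-weight) Lin--Lu--Yau curvature of $e=xy$ is $\kappa_e(w)=\lim_{\alpha\uparrow1}\frac{1-W_1(m_x^\alpha,m_y^\alpha)/w_e}{1-\alpha}$, with $W_1$ the $1$-Wasserstein distance for $d_w$. Known formula on trees: $\kappa_{xy}(w)=\frac{2-d_x}{w_{xy}D_x(w)}+\frac{2-d_y}{w_{xy}D_y(w)}$. $\overline\Delta_E=\{q\in\mathbb R^E:q_e\ge0,\ \sum_e q_e=1\}$. For a normalized trajectory $w$, $\omega(w)$ is the set of omega-limit points, i.e. of $w^*\in\overline\Delta_E$ with $w(t_j)\to w^*$ for some sequence $t_j\to\infty$; for $p\in\overline\Delta_E$, $E^+(p)=\{e\in E:p_e>0\}$. $\|\cdot\|$ is the Euclidean norm. *)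

theory Defs
  imports "HOL-Analysis.Analysis"
begin

section \<open>Finite trees\<close>

text \<open>
  A graph is a vertex set \<open>V\<close> together with a set \<open>E\<close> of two-element subsets of \<open>V\<close>.
  Walks are nonempty lists of vertices.
\<close>

definition simple_graph :: "'v set \<Rightarrow> 'v set set \<Rightarrow> bool" where
  "simple_graph V E \<longleftrightarrow> E \<subseteq> {{x, y} | x y. x \<in> V \<and> y \<in> V \<and> x \<noteq> y}"

definition graph_walk :: "'v set \<Rightarrow> 'v set set \<Rightarrow> 'v \<Rightarrow> 'v list \<Rightarrow> 'v \<Rightarrow> bool" where
  "graph_walk V E x xs y \<longleftrightarrow>
     xs \<noteq> [] \<and> set xs \<subseteq> V \<and> hd xs = x \<and> last xs = y \<and> successively (\<lambda>a b. {a, b} \<in> E) xs"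

definition graph_connected :: "'v set \<Rightarrow> 'v set set \<Rightarrow> bool" where
  "graph_connected V E \<longleftrightarrow> V \<noteq> {} \<and> (\<forall>x\<in>V. \<forall>y\<in>V. \<exists>xs. graph_walk V E x xs y)"

text \<open>The closing edge from the last vertex to the first is not repeated in the list.\<close>

definition graph_cycle :: "'v set set \<Rightarrow> 'v list \<Rightarrow> bool" where
  "graph_cycle E xs \<longleftrightarrow>
     3 \<le> length xs \<and> distinct xs \<and> successively (\<lambda>a b. {a, b} \<in> E) xs \<and> {last xs, hd xs} \<in> E"

definition finite_tree :: "'v set \<Rightarrow> 'v set set \<Rightarrow> bool" where
  "finite_tree V E \<longleftrightarrow>
     finite V \<and> simple_graph V E \<and> graph_connected V E \<and> (\<nexists>xs. graph_cycle E xs)"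


section \<open>Lin--Lu--Yau curvature with inverse weights\<close>

text \<open>
  A metric is a function on sets of vertices of which only the values on \<open>E\<close> are relevant.
\<close>

definition positive_metric :: "'v set set \<Rightarrow> ('v set \<Rightarrow> real) \<Rightarrow> bool" where
  "positive_metric E w \<longleftrightarrow> (\<forall>e\<in>E. 0 < w e)"

fun walk_length :: "('v set \<Rightarrow> real) \<Rightarrow> 'v list \<Rightarrow> real" where
  "walk_length w (x # y # xs) = w {x, y} + walk_length w (y # xs)"
| "walk_length w _ = 0"

definition path_metric :: "'v set \<Rightarrow> 'v set set \<Rightarrow> ('v set \<Rightarrow> real) \<Rightarrow> 'v \<Rightarrow> 'v \<Rightarrow> real" where
  "path_metric V E w x y = Inf {walk_length w xs | xs. graph_walk V E x xs y}"

definition inv_weight_degree :: "'v set set \<Rightarrow> ('v set \<Rightarrow> real) \<Rightarrow> 'v \<Rightarrow> real" where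
  "inv_weight_degree E w x = (\<Sum>e | e \<in> E \<and> x \<in> e. 1 / w e)"

definition lazy_measure :: "'v set set \<Rightarrow> ('v set \<Rightarrow> real) \<Rightarrow> real \<Rightarrow> 'v \<Rightarrow> 'v \<Rightarrow> real" where
  "lazy_measure E w \<alpha> x z =
     (if z = x then \<alpha>
      else if {x, z} \<in> E then (1 - \<alpha>) * inverse (w {x, z}) / inv_weight_degree E w x
      else 0)"

definition coupling :: "'v set \<Rightarrow> ('v \<Rightarrow> real) \<Rightarrow> ('v \<Rightarrow> real) \<Rightarrow> ('v \<Rightarrow> 'v \<Rightarrow> real) \<Rightarrow> bool" where
  "coupling V \<mu> \<nu> \<pi> \<longleftrightarrow>
     (\<forall>a\<in>V. \<forall>b\<in>V. 0 \<le> \<pi> a b) \<and>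
     (\<forall>a\<in>V. (\<Sum>b\<in>V. \<pi> a b) = \<mu> a) \<and>
     (\<forall>b\<in>V. (\<Sum>a\<in>V. \<pi> a b) = \<nu> b)"

definition wasserstein1 ::
  "'v set \<Rightarrow> ('v \<Rightarrow> 'v \<Rightarrow> real) \<Rightarrow> ('v \<Rightarrow> real) \<Rightarrow> ('v \<Rightarrow> real) \<Rightarrow> real" where
  "wasserstein1 V d \<mu> \<nu> = Inf {\<Sum>a\<in>V. \<Sum>b\<in>V. d a b * \<pi> a b | \<pi>. coupling V \<mu> \<nu> \<pi>}"

text \<open>The curvature of the edge \<open>{x, y}\<close>, as a function of its two endpoints.\<close>

definition lly_curvature ::
  "'v set \<Rightarrow> 'v set set \<Rightarrow> ('v set \<Rightarrow> real) \<Rightarrow> 'v \<Rightarrow> 'v \<Rightarrow> real" where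
  "lly_curvature V E w x y =
     Lim (at_left 1) (\<lambda>\<alpha>.
       (1 - wasserstein1 V (path_metric V E w) (lazy_measure E w \<alpha> x) (lazy_measure E w \<alpha> y)
              / w {x, y}) / (1 - \<alpha>))"


section \<open>The flow and its normalization\<close>

text \<open>
  Only the initial metric is required to be positive. The curvature is meaningful for positive
  metrics only, so while the trajectory is positive this is the usual flow; positivity at later
  times is a consequence of the equation and not part of the definition.
\<close>

definition ricci_flow_solution ::
  "'v set \<Rightarrow> 'v set set \<Rightarrow> (real \<Rightarrow> 'v set \<Rightarrow> real) \<Rightarrow> bool" where
  "ricci_flow_solution V E w \<longleftrightarrow>
     positive_metric E (w 0) \<and>
     (\<forall>t\<ge>0. \<forall>x y. {x, y} \<in> E \<longrightarrow>
        ((\<lambda>s. w s {x, y}) has_real_derivative - lly_curvature V E (w t) x y * w t {x, y})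
          (at t within {0..}))"

text \<open>
  The space of real vectors indexed by \<open>E\<close> is represented by the functions that vanish outside
  \<open>E\<close>. For finite \<open>E\<close> the product topology of the function type induces the usual topology
  on it.
\<close>

definition normalize_metric :: "'v set set \<Rightarrow> ('v set \<Rightarrow> real) \<Rightarrow> 'v set \<Rightarrow> real" where
  "normalize_metric E w e = (if e \<in> E then w e / (\<Sum>f\<in>E. w f) else 0)"

definition closed_simplex :: "'v set set \<Rightarrow> ('v set \<Rightarrow> real) set" where
  "closed_simplex E =
     {q. (\<forall>e\<in>E. 0 \<le> q e) \<and> (\<Sum>e\<in>E. q e) = 1 \<and> (\<forall>e. e \<notin> E \<longrightarrow> q e = 0)}"

definition omega_limit_set ::
  "'v set set \<Rightarrow> (real \<Rightarrow> 'v set \<Rightarrow> real) \<Rightarrow> ('v set \<Rightarrow> real) set" where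
  "omega_limit_set E w =
     {p \<in> closed_simplex E.
        \<exists>\<tau>::nat \<Rightarrow> real. filterlim \<tau> at_top sequentially \<and> (\<lambda>j. w (\<tau> j)) \<longlonglongrightarrow> p}"

definition positive_edges :: "'v set set \<Rightarrow> ('v set \<Rightarrow> real) \<Rightarrow> 'v set set" where
  "positive_edges E p = {e \<in> E. 0 < p e}"

definition rescale ::
  "'v set set \<Rightarrow> ('v set \<Rightarrow> real) \<Rightarrow> ('v set \<Rightarrow> real) \<Rightarrow> 'v set \<Rightarrow> real" where
  "rescale E r p e = r e * p e / (\<Sum>f\<in>E. r f * p f)"

end

theory Submission
  imports Defs
begin

text \<open>
  On a tree the flow reads \<open>w\<^sub>e' = \<Sum>x\<in>e. (d\<^sub>x - 2) / D\<^sub>x(w)\<close>. In logarithmic coordinates it is the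
  gradient flow of a convex function, and the logarithms of the ratios \<open>\<rho>\<^sub>e = v\<^sub>e / w\<^sub>e\<close> obey a consensus
  dynamics with symmetric nonnegative weights. Hence \<open>\<Sum>e. \<psi>(\<rho>\<^sub>e)\<close> is nonincreasing whenever
  \<open>z \<psi>'(z)\<close> is nondecreasing. The choices \<open>\<psi>(z) = z\<close> and \<open>\<psi>(z) = 1/z\<close> bound the ratios; on the
  resulting compact interval every polynomial is a difference of two admissible \<open>\<psi>\<close>, so every
  symmetric polynomial sum \<open>\<Sum>e. P(\<rho>\<^sub>e)\<close> converges. Thus all limit points of \<open>\<rho>\<close> have
  coordinates in one finite set, and by continuity each \<open>\<rho>\<^sub>e\<close> converges.
\<close>

section \<open>Curvature of trees\<close>

text \<open>Two edges \<open>e\<close>, \<open>f\<close> at a vertex \<open>x\<close> interact with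
  weight \<open>(d\<^sub>x - 2) / (D\<^sub>x(w) D\<^sub>x(v) v\<^sub>e v\<^sub>f)\<close>, acting on
  \<open>\<rho>\<^sub>f - \<rho>\<^sub>e\<close>. These weights depend on time and have no positive
  lower bound, so agreement of the ratios cannot be expected: on a path all interactions vanish and
  every ratio keeps its initial value. The limits may therefore differ from edge to edge, and only
  monotone quantities are at hand. The condition on \<open>z \<psi>'(z)\<close> says that
  \<open>\<psi>\<close> is convex as a function of \<open>ln z\<close>; symmetry of the weights then
  makes the derivative of the sum a sum over pairs of edges with a fixed sign. A second obstacle
  lies in the definitions. The curvature is a limit of transport costs and a solution is only
  required to start positive, so the closed form of the flow is usable at a given time only once
  positivity at that time is known. Positivity is therefore obtained from the equation before two
  solutions are compared.\<close>

lemma rtranclp_imp_distinct_walk: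
  assumes "R\<^sup>*\<^sup>* a b"
  shows "\<exists>xs. xs \<noteq> [] \<and> hd xs = a \<and> last xs = b \<and> distinct xs \<and> successively R xs"
  using assms
proof (induction rule: converse_rtranclp_induct)
  case base
  show ?case by (rule exI[of _ "[b]"]) simp
next
  case (step a c)
  then obtain xs where xs: "xs \<noteq> []" "hd xs = c" "last xs = b" "distinct xs" "successively R xs"
    by blast
  show ?case
  proof (cases "a \<in> set xs")
    case True
    \<comment> \<open>Loop erasure: instead of prepending a repeated vertex, the walk is cut back to
      its occurrence of \<open>a\<close>.\<close>
    then obtain ys zs where "xs = ys @ a # zs" by (meson split_list)
    with xs show ?thesis
      by (intro exI[of _ "a # zs"]) (auto simp: successively_append_iff)
  next
    case False
    with xs step.hyps show ?thesis
      by (intro exI[of _ "a # xs"]) (auto simp: successively_Cons)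
  qed
qed

text \<open>In a tree, for an edge \<open>g\<close>, this says that the path from \<open>a\<close>
  to \<open>b\<close> uses \<open>g\<close>. Phrasing it by reachability after deleting
  \<open>g\<close> avoids choosing paths, and sums over separating edges replace distances.\<close>

definition separates :: "'v set set \<Rightarrow> 'v set \<Rightarrow> 'v \<Rightarrow> 'v \<Rightarrow> bool" where
  "separates E g a b \<longleftrightarrow> \<not> (\<lambda>u v. {u, v} \<in> E - {g})\<^sup>*\<^sup>* a b"

lemma not_separates_refl [simp]: "\<not> separates E g a a"
  by (simp add: separates_def)

lemma separates_sym: "separates E g a b \<longleftrightarrow> separates E g b a"
proof -
  have "symp (\<lambda>u v. {u, v} \<in> E - {g})"
    by (auto intro!: sympI simp: insert_commute)
  then have "symp (\<lambda>u v. {u, v} \<in> E - {g})\<^sup>*\<^sup>*"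
    by (rule symp_rtranclp)
  then show ?thesis by (auto simp: separates_def dest: sympD)
qed

lemma separates_cong_edge:
  assumes "{b, c} \<in> E" "{b, c} \<noteq> g"
  shows "separates E g a b \<longleftrightarrow> separates E g a c"
proof -
  have "{c, b} \<in> E - {g}" "{b, c} \<in> E - {g}" using assms by (auto simp: insert_commute)
  then show ?thesis unfolding separates_def
    by (meson rtranclp.rtrancl_into_rtrancl)
qed

text \<open>A distinct walk from \<open>a\<close> to \<open>b\<close> that avoids the edge
  \<open>{a, b}\<close> is closed by this edge to a cycle. It has at least three vertices because a
  single vertex would give \<open>a = b\<close> and two would use the deleted edge.\<close>

lemma separates_bridge:
  assumes acyclic: "\<nexists>xs. graph_cycle E xs" and e: "{a, b} \<in> E" "a \<noteq> b"
  shows "separates E {a, b} a b"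
proof (rule ccontr)
  assume "\<not> ?thesis"
  then have "(\<lambda>u v. {u, v} \<in> E - {{a, b}})\<^sup>*\<^sup>* a b" by (simp add: separates_def)
  from rtranclp_imp_distinct_walk[OF this] obtain xs where
    xs: "xs \<noteq> []" "hd xs = a" "last xs = b" "distinct xs"
      "successively (\<lambda>u v. {u, v} \<in> E - {{a, b}}) xs" by blast
  have "3 \<le> length xs"
  proof (rule ccontr)
    assume "\<not> 3 \<le> length xs"
    with xs(1) consider u where "xs = [u]" | u v where "xs = [u, v]"
      by (cases xs rule: remdups_adj.cases) (auto simp: Suc_le_eq)
    then show False using xs e by cases auto
  qed
  moreover have "successively (\<lambda>u v. {u, v} \<in> E) xs"
    using xs(5) by (rule successively_mono) auto
  ultimately have "graph_cycle E xs"
    using xs e by (auto simp: graph_cycle_def insert_commute)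
  then show False using acyclic by blast
qed

section \<open>Kantorovich duality and an explicit coupling\<close>

lemma walk_length_ge:
  fixes f :: "'v \<Rightarrow> real"
  assumes lip: "\<And>u v. {u, v} \<in> E \<Longrightarrow> f v - f u \<le> w {u, v}"
    and "successively (\<lambda>a b. {a, b} \<in> E) xs" "xs \<noteq> []"
  shows "f (last xs) - f (hd xs) \<le> walk_length w xs"
  using assms(2,3)
proof (induction xs rule: induct_list012)
  case (3 x y xs)
  then have "f (last (y # xs)) - f y \<le> walk_length w (y # xs)" "{x, y} \<in> E" by auto
  with lip[of x y] show ?case by auto
qed auto

text \<open>Weak duality with complementary slackness: the cost of any coupling is at least the dual
  value of the potential \<open>f\<close>, and a coupling charging only pairs at which
  \<open>f\<close> is tight attains it, so the infimum is a minimum.\<close>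

lemma wasserstein1_eqI:
  assumes "coupling V \<mu> \<nu> \<pi>"
    and lip: "\<And>a b. a \<in> V \<Longrightarrow> b \<in> V \<Longrightarrow> f b - f a \<le> d a b"
    and tight: "\<And>a b. a \<in> V \<Longrightarrow> b \<in> V \<Longrightarrow> \<pi> a b \<noteq> 0 \<Longrightarrow> d a b \<le> f b - f a"
  shows "wasserstein1 V d \<mu> \<nu> = (\<Sum>b\<in>V. f b * \<nu> b) - (\<Sum>a\<in>V. f a * \<mu> a)"
proof -
  have dual: "(\<Sum>a\<in>V. \<Sum>b\<in>V. (f b - f a) * \<pi> a b) = (\<Sum>b\<in>V. f b * \<nu> b) - (\<Sum>a\<in>V. f a * \<mu> a)"
    if "coupling V \<mu> \<nu> \<pi>" for \<pi>
  proof -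
    have "(\<Sum>a\<in>V. \<Sum>b\<in>V. f b * \<pi> a b) = (\<Sum>b\<in>V. f b * (\<Sum>a\<in>V. \<pi> a b))"
      by (subst sum.swap) (simp add: sum_distrib_left)
    moreover have "(\<Sum>a\<in>V. \<Sum>b\<in>V. f a * \<pi> a b) = (\<Sum>a\<in>V. f a * (\<Sum>b\<in>V. \<pi> a b))"
      by (simp add: sum_distrib_left)
    ultimately show ?thesis using that
      by (simp add: coupling_def left_diff_distrib sum_subtractf)
  qed
  have eq: "(\<Sum>a\<in>V. \<Sum>b\<in>V. d a b * \<pi> a b) = (\<Sum>b\<in>V. f b * \<nu> b) - (\<Sum>a\<in>V. f a * \<mu> a)"
    unfolding dual[OF assms(1), symmetric]
  proof (intro sum.cong refl)
    fix a b assume "a \<in> V" "b \<in> V"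
    then show "d a b * \<pi> a b = (f b - f a) * \<pi> a b"
      using lip[of a b] tight[of a b] by (cases "\<pi> a b = 0") auto
  qed
  show ?thesis unfolding wasserstein1_def
  proof (rule cInf_eq_minimum)
    show "(\<Sum>b\<in>V. f b * \<nu> b) - (\<Sum>a\<in>V. f a * \<mu> a) \<in>
      {\<Sum>a\<in>V. \<Sum>b\<in>V. d a b * \<pi> a b |\<pi>. coupling V \<mu> \<nu> \<pi>}"
      unfolding mem_Collect_eq using eq assms(1) by (intro exI[of _ \<pi>]) simp
  next
    fix c assume "c \<in> {\<Sum>a\<in>V. \<Sum>b\<in>V. d a b * \<pi> a b |\<pi>. coupling V \<mu> \<nu> \<pi>}"
    then obtain \<pi>' where \<pi>': "coupling V \<mu> \<nu> \<pi>'" "c = (\<Sum>a\<in>V. \<Sum>b\<in>V. d a b * \<pi>' a b)" by auto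
    have "(\<Sum>a\<in>V. \<Sum>b\<in>V. (f b - f a) * \<pi>' a b) \<le> c"
      unfolding \<pi>'(2) using \<pi>'(1) lip
      by (intro sum_mono mult_right_mono) (auto simp: coupling_def)
    then show "(\<Sum>b\<in>V. f b * \<nu> b) - (\<Sum>a\<in>V. f a * \<mu> a) \<le> c"
      using dual[OF \<pi>'(1)] by simp
  qed
qed

text \<open>The masses \<open>\<nu> x\<close> at \<open>x\<close> and \<open>\<mu> y\<close> at \<open>y\<close> stay in place; the remaining masses are coupled
  independently. For lazy measures near \<open>\<alpha> = 1\<close> this charges only pairs at which the potential
  below is tight.\<close>

definition fixing_coupling ::
  "'v \<Rightarrow> 'v \<Rightarrow> ('v \<Rightarrow> real) \<Rightarrow> ('v \<Rightarrow> real) \<Rightarrow> 'v \<Rightarrow> 'v \<Rightarrow> real" where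
  "fixing_coupling x y \<mu> \<nu> a b =
     (let k = (\<lambda>c. if c = x then \<nu> x else if c = y then \<mu> y else 0)
      in (if a = b then k a else 0) + (\<mu> a - k a) * (\<nu> b - k b) / (1 - \<mu> y - \<nu> x))"

text \<open>Once the fixed masses \<open>k\<close> are removed, both measures keep the same total
  \<open>M\<close>, so the product of the remainders divided by \<open>M\<close> has these
  remainders as marginals. The assumptions \<open>le\<close> keep the remainders nonnegative and
  \<open>M\<close> positive.\<close>

lemma coupling_fixing_coupling:
  assumes V: "finite V" "x \<in> V" "y \<in> V" "x \<noteq> y"
    and nonneg: "\<And>a. 0 \<le> \<mu> a" "\<And>a. 0 \<le> \<nu> a" and total: "sum \<mu> V = 1" "sum \<nu> V = 1"
    and le: "\<nu> x \<le> \<mu> x" "\<mu> y \<le> \<nu> y" "\<mu> y + \<nu> x < 1"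
  shows "coupling V \<mu> \<nu> (fixing_coupling x y \<mu> \<nu>)"
proof -
  define k where "k = (\<lambda>c. if c = x then \<nu> x else if c = y then \<mu> y else 0)"
  define M where "M = 1 - \<mu> y - \<nu> x"
  have M: "M > 0" using le by (simp add: M_def)
  have eq: "fixing_coupling x y \<mu> \<nu> a b = (if a = b then k a else 0) + (\<mu> a - k a) * (\<nu> b - k b) / M"
    for a b by (simp add: fixing_coupling_def k_def M_def Let_def)
  have k: "0 \<le> k c" "k c \<le> \<mu> c" "k c \<le> \<nu> c" for c
    using nonneg le by (auto simp: k_def)
  have "sum k V = (\<Sum>c\<in>V. (if c = x then \<nu> x else 0) + (if c = y then \<mu> y else 0))"
    using V by (intro sum.cong) (auto simp: k_def)
  then have "sum k V = 1 - M" using V by (simp add: sum.distrib M_def)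
  then have s: "(\<Sum>a\<in>V. \<mu> a - k a) = M" "(\<Sum>a\<in>V. \<nu> a - k a) = M"
    using total by (simp_all add: sum_subtractf)
  show ?thesis unfolding coupling_def eq
  proof (intro conjI ballI)
    fix a assume "a \<in> V"
    then show "(\<Sum>b\<in>V. (if a = b then k a else 0) + (\<mu> a - k a) * (\<nu> b - k b) / M) = \<mu> a"
      using V M s by (simp add: sum.distrib sum_divide_distrib[symmetric] sum_distrib_left[symmetric])
  next
    fix b assume "b \<in> V"
    then show "(\<Sum>a\<in>V. (if a = b then k a else 0) + (\<mu> a - k a) * (\<nu> b - k b) / M) = \<nu> b"
      using V M s by (simp add: sum.distrib sum_divide_distrib[symmetric] sum_distrib_right[symmetric])
  next
    fix a b
    show "0 \<le> (if a = b then k a else 0) + (\<mu> a - k a) * (\<nu> b - k b) / M"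
      using k M by (auto intro!: add_nonneg_nonneg divide_nonneg_pos mult_nonneg_nonneg)
  qed
qed

section \<open>Degrees and lazy measures on a weighted tree\<close>

locale weighted_tree =
  fixes V :: "'v set" and E :: "'v set set" and w :: "'v set \<Rightarrow> real"
  assumes tree: "finite_tree V E" and pos: "positive_metric E w"
begin

lemma finite_V: "finite V" and acyclic: "\<nexists>xs. graph_cycle E xs" and connected: "graph_connected V E"
  using tree by (auto simp: finite_tree_def)

lemma edgeD: "{a, b} \<in> E \<Longrightarrow> a \<in> V \<and> b \<in> V \<and> a \<noteq> b"
  using tree by (auto simp: finite_tree_def simple_graph_def doubleton_eq_iff)

lemma no_loop [simp]: "{a} \<notin> E"
  using edgeD[of a a] by auto

lemma edgeE:
  assumes "e \<in> E" obtains a b where "e = {a, b}" "a \<in> V" "b \<in> V" "a \<noteq> b"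
proof -
  have "e \<in> {{x, y} | x y. x \<in> V \<and> y \<in> V \<and> x \<noteq> y}"
    using tree assms by (auto simp only: finite_tree_def simple_graph_def)
  then show ?thesis using that by blast
qed

lemma finite_E: "finite E"
proof (rule finite_subset)
  show "E \<subseteq> Pow V" by (auto elim: edgeE)
qed (simp add: finite_V)

lemma bridge: "{a, b} \<in> E \<Longrightarrow> separates E {a, b} a b"
  using separates_bridge[OF acyclic] edgeD by blast

lemma w_pos: "e \<in> E \<Longrightarrow> 0 < w e"
  using pos by (simp add: positive_metric_def)

definition nbrs :: "'v \<Rightarrow> 'v set" where "nbrs x = {z. {x, z} \<in> E}"

lemma nbrs_iff [simp]: "z \<in> nbrs x \<longleftrightarrow> {x, z} \<in> E"
  by (simp add: nbrs_def)

lemma finite_nbrs: "finite (nbrs x)"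
  by (rule finite_subset[OF _ finite_V]) (auto simp: nbrs_def dest: edgeD)

lemma sum_nbrs: "(\<Sum>z\<in>nbrs x. h {x, z}) = (\<Sum>e | e \<in> E \<and> x \<in> e. h e)"
proof (rule sum.reindex_bij_betw)
  have "inj_on (\<lambda>z. {x, z}) (nbrs x)"
    by (auto simp: inj_on_def doubleton_eq_iff)
  moreover have "(\<lambda>z. {x, z}) ` nbrs x = {e \<in> E. x \<in> e}"
  proof (intro equalityI subsetI)
    fix e assume "e \<in> {e \<in> E. x \<in> e}"
    then obtain a b where "e = {a, b}" "e \<in> E" "x = a \<or> x = b" using edgeE by blast
    then show "e \<in> (\<lambda>z. {x, z}) ` nbrs x" by (auto simp: insert_commute)
  qed auto
  ultimately show "bij_betw (\<lambda>z. {x, z}) (nbrs x) {e \<in> E. x \<in> e}"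
    by (simp add: bij_betw_def)
qed

lemma card_nbrs: "card (nbrs x) = card {e \<in> E. x \<in> e}"
  using sum_nbrs[of "\<lambda>_. 1::nat" x] by simp

abbreviation D :: "'v \<Rightarrow> real" where "D \<equiv> inv_weight_degree E w"

lemma D_pos: "{x, y} \<in> E \<Longrightarrow> 0 < D x"
  unfolding inv_weight_degree_def
  by (rule sum_pos2[of _ "{x,y}"]) (auto simp: finite_E w_pos intro: less_imp_le)

lemma sum_lazy_measure:
  assumes "x \<in> V"
  shows "(\<Sum>a\<in>V. f a * lazy_measure E w \<alpha> x a) =
    \<alpha> * f x + (1 - \<alpha>) / D x * (\<Sum>z\<in>nbrs x. f z / w {x, z})"
proof -
  have "(\<Sum>a\<in>V. f a * lazy_measure E w \<alpha> x a) = (\<Sum>a\<in>V. (if a = x then \<alpha> * f x else 0) +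
      (if a \<in> nbrs x then (1 - \<alpha>) / D x * (f a / w {x, a}) else 0))"
    by (intro sum.cong) (auto simp: lazy_measure_def divide_inverse dest: edgeD)
  also have "\<dots> = \<alpha> * f x + (\<Sum>z\<in>V \<inter> nbrs x. (1 - \<alpha>) / D x * (f z / w {x, z}))"
    using finite_V assms by (simp only: sum.distrib sum.inter_restrict) simp
  also have "V \<inter> nbrs x = nbrs x" by (auto dest: edgeD)
  finally show ?thesis by (simp add: sum_distrib_left)
qed

lemma lazy_measure_nonneg: "0 \<le> \<alpha> \<Longrightarrow> \<alpha> \<le> 1 \<Longrightarrow> 0 \<le> lazy_measure E w \<alpha> x a"
  using w_pos[of "{x, a}"] D_pos[of x a]
  by (auto simp: lazy_measure_def intro!: divide_nonneg_pos mult_nonneg_nonneg)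

lemma lazy_measure_total:
  assumes "{x, y} \<in> E"
  shows "(\<Sum>a\<in>V. lazy_measure E w \<alpha> x a) = 1"
proof -
  have "(\<Sum>z\<in>nbrs x. 1 / w {x, z}) = D x"
    using sum_nbrs[of "\<lambda>e. 1 / w e" x] by (simp add: inv_weight_degree_def)
  then show ?thesis
    using sum_lazy_measure[of x "\<lambda>_. 1" \<alpha>] D_pos[OF assms] edgeD[OF assms] by simp
qed

lemma lazy_measure_edge_le:
  assumes "{x, y} \<in> E" "0 \<le> \<alpha>" "\<alpha> \<le> 1"
  shows "lazy_measure E w \<alpha> x y \<le> 1 - \<alpha>"
proof -
  have "lazy_measure E w \<alpha> x x + lazy_measure E w \<alpha> x y = sum (lazy_measure E w \<alpha> x) {x, y}"
    using edgeD[OF assms(1)] by simp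
  also have "\<dots> \<le> sum (lazy_measure E w \<alpha> x) V"
    using assms edgeD[OF assms(1)] by (intro sum_mono2 finite_V) (auto intro: lazy_measure_nonneg)
  finally show ?thesis using lazy_measure_total[OF assms(1)] by (simp add: lazy_measure_def)
qed

section \<open>Path metric, Kantorovich potential and the curvature formula\<close>

lemma walk_length_nonneg: "graph_walk V E a xs b \<Longrightarrow> 0 \<le> walk_length w xs"
  using walk_length_ge[of E "\<lambda>_. 0" w xs] w_pos by (auto simp: graph_walk_def intro: less_imp_le)

lemma path_metric_le:
  assumes "graph_walk V E a xs b" shows "path_metric V E w a b \<le> walk_length w xs"
  unfolding path_metric_def
  by (rule cInf_lower) (use assms walk_length_nonneg in \<open>auto intro!: bdd_belowI[of _ 0]\<close>)

lemma path_metric_ge: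
  assumes "\<And>u v. {u, v} \<in> E \<Longrightarrow> f v - f u \<le> w {u, v}" and "a \<in> V" "b \<in> V"
  shows "f b - f a \<le> path_metric V E w a b"
  unfolding path_metric_def
proof (rule cInf_greatest)
  show "{walk_length w xs |xs. graph_walk V E a xs b} \<noteq> {}"
    using connected assms by (auto simp: graph_connected_def)
qed (use walk_length_ge[of E f w, OF assms(1)] in \<open>auto simp: graph_walk_def\<close>)

text \<open>The Kantorovich potential for the edge \<open>{x, y}\<close>: the distance from \<open>x\<close>, where the
  contributions of the edges at \<open>x\<close> other than \<open>{x, y}\<close> are counted negatively.\<close>

definition potential :: "'v \<Rightarrow> 'v \<Rightarrow> 'v \<Rightarrow> real" where
  "potential x y u =
     (\<Sum>g\<in>E. (if x \<in> g \<and> g \<noteq> {x, y} then -1 else 1) * w g * of_bool (separates E g x u))"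

text \<open>Along the edge \<open>{u, v}\<close> only the summand of this very edge can change, and
  whatever its sign it changes by at most the weight.\<close>

lemma potential_lipschitz:
  assumes "{u, v} \<in> E"
  shows "potential x y v - potential x y u \<le> w {u, v}"
proof -
  have "potential x y v - potential x y u = (\<Sum>g\<in>E. (if x \<in> g \<and> g \<noteq> {x, y} then -1 else 1) * w g *
     (of_bool (separates E g x v) - of_bool (separates E g x u)))"
    by (simp add: potential_def sum_subtractf right_diff_distrib)
  also have "\<dots> \<le> (\<Sum>g\<in>E. if g = {u, v} then w {u, v} else 0)"
  proof (rule sum_mono)
    fix g assume g: "g \<in> E"
    define s :: real where "s = (if x \<in> g \<and> g \<noteq> {x, y} then -1 else 1)"
    define \<delta> :: real where "\<delta> = of_bool (separates E g x v) - of_bool (separates E g x u)"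
    have "s * \<delta> \<le> 1" by (simp add: s_def \<delta>_def)
    then have "s * w g * \<delta> \<le> w g" using w_pos[OF g] by (simp add: mult.commute mult.left_commute)
    moreover have "\<delta> = 0" if "g \<noteq> {u, v}"
      using separates_cong_edge[of u v E g x] assms that by (simp add: \<delta>_def)
    ultimately show "s * w g * \<delta> \<le> (if g = {u, v} then w {u, v} else 0)"
      by (cases "g = {u, v}") simp_all
  qed
  also have "\<dots> = w {u, v}" using assms finite_E by simp
  finally show ?thesis .
qed

lemma potential_source: "potential x y x = 0"
  by (simp add: potential_def)

lemma potential_nbr:
  assumes "{x, z} \<in> E"
  shows "potential x y z = (if z = y then w {x, z} else - w {x, z})"
proof -
  have "separates E g x z \<longleftrightarrow> g = {x, z}" if "g \<in> E" for g
    using separates_cong_edge[of x z E g x] bridge[of x z] assms by (cases "g = {x, z}") simp_all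
  moreover have "{x, z} = {x, y} \<longleftrightarrow> z = y" by (auto simp: doubleton_eq_iff)
  ultimately have "potential x y z =
    (\<Sum>g\<in>E. if g = {x, z} then (if z = y then w {x, z} else - w {x, z}) else 0)"
    unfolding potential_def by (intro sum.cong) simp_all
  then show ?thesis using assms finite_E by simp
qed

text \<open>Exactly \<open>{x, y}\<close> and \<open>{y, z}\<close> separate \<open>x\<close> from
  \<open>z\<close>, and neither carries the negative sign: the first is exempt and the second does
  not contain \<open>x\<close>.\<close>

lemma potential_far:
  assumes "{x, y} \<in> E" "{y, z} \<in> E" "z \<noteq> x"
  shows "potential x y z = w {x, y} + w {y, z}"
proof -
  have "separates E g x z \<longleftrightarrow> g = {x, y} \<or> g = {y, z}" if "g \<in> E" for g
  proof -
    have ne: "{x, y} \<noteq> {y, z}" using assms edgeD[OF assms(1)] by (auto simp: doubleton_eq_iff)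
    consider "g = {x, y}" | "g = {y, z}" | "g \<noteq> {x, y}" "g \<noteq> {y, z}" by blast
    then show ?thesis
    proof cases
      case 1
      then show ?thesis using ne separates_cong_edge[of y z E g x] bridge[of x y] assms by simp
    next
      case 2
      then have "separates E g z x \<longleftrightarrow> separates E g z y"
        using ne separates_cong_edge[of x y E g z] assms by simp
      then show ?thesis using 2 bridge[of y z] assms by (simp add: separates_sym)
    next
      case 3
      then show ?thesis
        using separates_cong_edge[of y z E g x] separates_cong_edge[of x y E g x] assms by simp
    qed
  qed
  moreover have "x \<notin> {y, z}" "{x, y} \<noteq> {y, z}" using assms edgeD[OF assms(1)] by auto
  ultimately have "potential x y z =
    (\<Sum>g\<in>E. (if g = {x, y} then w {x, y} else 0) + (if g = {y, z} then w {y, z} else 0))"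
    unfolding potential_def by (intro sum.cong) simp_all
  then show ?thesis using assms finite_E by (simp add: sum.distrib)
qed

text \<open>These are the pairs that the coupling charges off the diagonal. The walk through
  \<open>a\<close>, \<open>x\<close>, \<open>y\<close>, \<open>b\<close>, without repetitions, has
  exactly the potential difference as its length, because the potential is \<open>- w {x, a}\<close>
  at a neighbour \<open>a\<close> of \<open>x\<close> other than \<open>y\<close>. With
  \<open>path_metric_ge\<close> the pairs are tight.\<close>

lemma path_metric_le_potential:
  assumes e: "{x, y} \<in> E"
    and a: "a = x \<or> {x, a} \<in> E \<and> a \<noteq> y" and b: "b = y \<or> {y, b} \<in> E \<and> b \<noteq> x"
  shows "path_metric V E w a b \<le> potential x y b - potential x y a"
proof -
  define xs where "xs = (if a = x then [] else [a]) @ [x, y] @ (if b = y then [] else [b])"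
  have "a \<in> V" "b \<in> V" "x \<in> V" "y \<in> V" using e a b edgeD by blast+
  then have "graph_walk V E a xs b"
    using e a b by (auto simp: graph_walk_def xs_def insert_commute[of a x])
  then have "path_metric V E w a b \<le> walk_length w xs" by (rule path_metric_le)
  also have "\<dots> = potential x y b - potential x y a"
    using a b e potential_nbr[of x y y] potential_nbr[of x a y] potential_far[of x y b]
    by (cases "a = x"; cases "b = y") (simp_all add: xs_def potential_source insert_commute[of a x])
  finally show ?thesis .
qed

lemma wasserstein1_lazy_measure:
  assumes e: "{x, y} \<in> E" and \<alpha>: "1/2 < \<alpha>" "\<alpha> < 1"
  shows "wasserstein1 V (path_metric V E w) (lazy_measure E w \<alpha> x) (lazy_measure E w \<alpha> y) =
    (\<Sum>b\<in>V. potential x y b * lazy_measure E w \<alpha> y b) -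
    (\<Sum>a\<in>V. potential x y a * lazy_measure E w \<alpha> x a)"
proof (rule wasserstein1_eqI)
  let ?\<mu> = "lazy_measure E w \<alpha> x" and ?\<nu> = "lazy_measure E w \<alpha> y"
  have e': "{y, x} \<in> E" using e by (simp add: insert_commute)
  \<comment> \<open>As \<open>1/2 < \<alpha>\<close>, both masses lie below \<open>\<alpha>\<close>
    and their sum lies below 1, which gives the inequalities required by
    \<open>coupling_fixing_coupling\<close>.\<close>
  have le: "?\<mu> y \<le> 1 - \<alpha>" "?\<nu> x \<le> 1 - \<alpha>"
    using lazy_measure_edge_le[of x y \<alpha>] lazy_measure_edge_le[of y x \<alpha>] e e' \<alpha> by auto
  have diag: "?\<mu> x = \<alpha>" "?\<nu> y = \<alpha>" by (simp_all add: lazy_measure_def)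
  show "coupling V ?\<mu> ?\<nu> (fixing_coupling x y ?\<mu> ?\<nu>)"
    using le \<alpha> edgeD[OF e] finite_V lazy_measure_total[OF e, of \<alpha>] lazy_measure_total[OF e', of \<alpha>]
    by (intro coupling_fixing_coupling) (auto simp: diag intro!: lazy_measure_nonneg)
  fix a b assume ab: "a \<in> V" "b \<in> V"
  show "potential x y b - potential x y a \<le> path_metric V E w a b"
    using path_metric_ge[of "potential x y" a b] potential_lipschitz ab by blast
  assume nz: "fixing_coupling x y ?\<mu> ?\<nu> a b \<noteq> 0"
  show "path_metric V E w a b \<le> potential x y b - potential x y a"
  proof (cases "a = b")
    case True
    have "graph_walk V E b [b] b" using ab by (simp add: graph_walk_def)
    from path_metric_le[OF this] True show ?thesis by simp
  next
    case False
    with nz have "a = x \<or> {x, a} \<in> E \<and> a \<noteq> y" "b = y \<or> {y, b} \<in> E \<and> b \<noteq> x"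
      using edgeD[OF e]
      by (auto simp: fixing_coupling_def lazy_measure_def Let_def split: if_splits)
    then show ?thesis by (rule path_metric_le_potential[OF e])
  qed
qed

text \<open>The transport cost is affine in \<open>\<alpha>\<close> for
  \<open>1/2 < \<alpha> < 1\<close>, so the quotient is constant there and the limit is that
  constant.\<close>

lemma lly_curvature_tree:
  assumes e: "{x, y} \<in> E"
  shows "lly_curvature V E w x y =
    ((2 - real (card {e \<in> E. x \<in> e})) / D x + (2 - real (card {e \<in> E. y \<in> e})) / D y) / w {x, y}"
proof -
  define dx dy where "dx = real (card {e \<in> E. x \<in> e})" and "dy = real (card {e \<in> E. y \<in> e})"
  have e': "{y, x} \<in> E" using e by (simp add: insert_commute)
  have yx: "{y, x} = {x, y}" by auto
  note V = edgeD[OF e] and wp = w_pos[OF e]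
  have Dp: "D x > 0" "D y > 0" using D_pos e e' by blast+
  have Dy: "(\<Sum>z\<in>nbrs y. 1 / w {y, z}) = D y"
    using sum_nbrs[of "\<lambda>e. 1 / w e" y] by (simp add: inv_weight_degree_def)
  \<comment> \<open>The neighbour \<open>x\<close> of \<open>y\<close> is the exception: its
    potential is zero, while the general expression would give 2.\<close>
  have "(\<Sum>z\<in>nbrs y. potential x y z / w {y, z}) =
    (\<Sum>z\<in>nbrs y. w {x, y} * (1 / w {y, z}) + 1 - (if z = x then 2 else 0))"
  proof (intro sum.cong refl)
    fix z assume "z \<in> nbrs y"
    then have "{y, z} \<in> E" by simp
    with w_pos[OF this] wp show "potential x y z / w {y, z} =
      w {x, y} * (1 / w {y, z}) + 1 - (if z = x then 2 else 0)"
      using potential_far[OF e, of z] potential_source[of x y] yx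
      by (cases "z = x") (simp_all add: field_simps)
  qed
  also have "\<dots> = w {x, y} * D y + dy - 2"
    using finite_nbrs e' card_nbrs[of y]
    by (simp only: sum.distrib sum_subtractf sum_distrib_left[symmetric] Dy) (simp add: dy_def)
  finally have sy: "(\<Sum>z\<in>nbrs y. potential x y z / w {y, z}) = w {x, y} * D y + dy - 2" .
  have "(\<Sum>z\<in>nbrs x. potential x y z / w {x, z}) = (\<Sum>z\<in>nbrs x. (if z = y then 2 else 0) - 1)"
  proof (intro sum.cong refl)
    fix z assume "z \<in> nbrs x"
    then have "{x, z} \<in> E" by simp
    with w_pos[OF this] show "potential x y z / w {x, z} = (if z = y then 2 else 0) - 1"
      using potential_nbr[of x z y] wp by (cases "z = y") simp_all
  qed
  also have "\<dots> = 2 - dx"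
    using finite_nbrs e card_nbrs[of x]
    by (simp only: sum_subtractf) (simp add: dx_def)
  finally have sx: "(\<Sum>z\<in>nbrs x. potential x y z / w {x, z}) = 2 - dx" .
  define c where "c = ((2 - dx) / D x + (2 - dy) / D y) / w {x, y}"
  have "(1 - wasserstein1 V (path_metric V E w) (lazy_measure E w \<alpha> x) (lazy_measure E w \<alpha> y)
      / w {x, y}) / (1 - \<alpha>) = c" if \<alpha>: "1/2 < \<alpha>" "\<alpha> < 1" for \<alpha>
  proof -
    have "wasserstein1 V (path_metric V E w) (lazy_measure E w \<alpha> x) (lazy_measure E w \<alpha> y) =
      \<alpha> * w {x, y} + (1 - \<alpha>) / D y * (w {x, y} * D y + dy - 2) - (1 - \<alpha>) / D x * (2 - dx)"
      using V by (simp add: wasserstein1_lazy_measure[OF e \<alpha>] sum_lazy_measure sx sy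
          potential_source potential_nbr[OF e])
    also have "\<dots> = w {x, y} * (1 - (1 - \<alpha>) * c)"
      using Dp wp by (simp add: c_def field_simps)
    finally show ?thesis using \<alpha> wp by simp
  qed
  moreover have "eventually (\<lambda>\<alpha>::real. \<alpha> \<in> {1/2<..<1}) (at_left 1)"
    by (rule eventually_at_left_real) simp
  ultimately have "eventually (\<lambda>\<alpha>. (1 - wasserstein1 V (path_metric V E w) (lazy_measure E w \<alpha> x)
      (lazy_measure E w \<alpha> y) / w {x, y}) / (1 - \<alpha>) = c) (at_left 1)"
    by (auto elim!: eventually_mono)
  then show ?thesis
    unfolding lly_curvature_def c_def dx_def dy_def
    by (intro tendsto_Lim tendsto_eventually) (simp_all add: trivial_limit_at_left_real)
qed

end

section \<open>Convergence from symmetric functions\<close>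

lemma nonincreasing_imp_tendsto_at_top:
  fixes f :: "real \<Rightarrow> real"
  assumes mono: "\<And>s t. 0 \<le> s \<Longrightarrow> s \<le> t \<Longrightarrow> f t \<le> f s" and bd: "\<And>t. 0 \<le> t \<Longrightarrow> B \<le> f t"
  shows "\<exists>L. (f \<longlongrightarrow> L) at_top"
proof -
  have bdd: "bdd_below (f ` {0..})" using bd by (auto intro!: bdd_belowI[of _ B])
  define L where "L = Inf (f ` {0..})"
  have "(f \<longlongrightarrow> L) at_top"
  proof (rule order_tendstoI)
    fix a assume "a < L"
    moreover have "L \<le> f t" if "t \<ge> 0" for t
      unfolding L_def using that by (intro cInf_lower bdd) auto
    ultimately show "eventually (\<lambda>t. a < f t) at_top"
      by (intro eventually_mono[OF eventually_ge_at_top[of 0]]) (auto intro: less_le_trans)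
  next
    fix a assume "L < a"
    then obtain s where "0 \<le> s" "f s < a"
      unfolding L_def using bdd by (subst (asm) cInf_less_iff) auto
    then show "eventually (\<lambda>t. f t < a) at_top"
      using mono[of s] by (intro eventually_mono[OF eventually_ge_at_top[of s]]) (auto intro: le_less_trans)
  qed
  then show ?thesis ..
qed

lemma finite_family_convergent_subseq:
  fixes b :: "nat \<Rightarrow> 'e \<Rightarrow> real"
  assumes "finite E" "\<And>e. e \<in> E \<Longrightarrow> bounded (range (\<lambda>n. b n e))"
  shows "\<exists>s l. strict_mono (s :: nat \<Rightarrow> nat) \<and> (\<forall>e\<in>E. (\<lambda>n. b (s n) e) \<longlonglongrightarrow> l e)"
  using assms
proof (induction E rule: finite_induct)
  case empty
  show ?case using strict_mono_id by auto
next
  case (insert k E)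
  then obtain s l where s: "strict_mono (s :: nat \<Rightarrow> nat)" "\<forall>e\<in>E. (\<lambda>n. b (s n) e) \<longlonglongrightarrow> l e"
    by auto
  have "bounded (range (\<lambda>n. b (s n) k))"
    by (rule bounded_subset[OF insert.prems[of k]]) auto
  from bounded_imp_convergent_subsequence[OF this] obtain l' s' where
    s': "strict_mono s'" "(\<lambda>n. b (s (s' n)) k) \<longlonglongrightarrow> l'" by (auto simp: o_def)
  have "(\<lambda>n. b (s (s' n)) e) \<longlonglongrightarrow> l e" if "e \<in> E" for e
    using LIMSEQ_subseq_LIMSEQ[OF s(2)[rule_format, OF that] s'(1)] by (simp add: o_def)
  then show ?case
    using s s' insert.hyps(2)
    by (intro exI[of _ "s \<circ> s'"] exI[of _ "l(k := l')"]) (auto simp: strict_mono_def)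
qed

text \<open>Near the zero \<open>l\<close> choose \<open>l \<plusminus> \<delta>\<close> that are not zeros: eventually the path can cross neither.\<close>

lemma tendsto_of_poly_tendsto_0:
  fixes a :: "real \<Rightarrow> real"
  assumes cont: "continuous_on {0..} a" and "P \<noteq> 0"
    and zero: "((\<lambda>t. poly P (a t)) \<longlongrightarrow> 0) at_top"
    and \<tau>: "filterlim \<tau> at_top sequentially" and lim: "(\<lambda>n. a (\<tau> n)) \<longlonglongrightarrow> l"
  shows "(a \<longlongrightarrow> l) at_top"
proof (rule tendstoI)
  fix \<epsilon> :: real assume "\<epsilon> > 0"
  let ?Z = "{x. poly P x = 0}"
  have "finite ((\<lambda>x. x - l) ` ?Z \<union> (\<lambda>x. l - x) ` ?Z)"
    using poly_roots_finite[OF \<open>P \<noteq> 0\<close>] by simp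
  then have "\<not> {0<..<\<epsilon>} \<subseteq> (\<lambda>x. x - l) ` ?Z \<union> (\<lambda>x. l - x) ` ?Z"
    using infinite_Ioo[OF \<open>\<epsilon> > 0\<close>] finite_subset by blast
  then obtain \<delta> where \<delta>: "0 < \<delta>" "\<delta> < \<epsilon>"
    "\<delta> \<notin> (\<lambda>x. x - l) ` ?Z" "\<delta> \<notin> (\<lambda>x. l - x) ` ?Z"
    unfolding subset_iff greaterThanLessThan_iff by blast
  have nz: "poly P (l + \<delta>) \<noteq> 0" "poly P (l - \<delta>) \<noteq> 0"
    using \<delta> by (auto simp: image_iff)
  \<comment> \<open>At both levels \<open>l + \<delta>\<close> and \<open>l - \<delta>\<close> the
    absolute value of \<open>P\<close> is at least this minimum, so a path with smaller values meets
    neither.\<close>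
  have "eventually (\<lambda>t. \<bar>poly P (a t)\<bar> < min \<bar>poly P (l + \<delta>)\<bar> \<bar>poly P (l - \<delta>)\<bar>) at_top"
    using tendstoD[OF zero, of "min \<bar>poly P (l + \<delta>)\<bar> \<bar>poly P (l - \<delta>)\<bar>"] nz by (simp add: dist_real_def)
  then obtain T0 where T0: "\<And>t. t \<ge> T0 \<Longrightarrow> \<bar>poly P (a t)\<bar> < min \<bar>poly P (l + \<delta>)\<bar> \<bar>poly P (l - \<delta>)\<bar>"
    by (auto simp: eventually_at_top_linorder)
  define T where "T = max T0 0"
  have avoid: "a t \<noteq> l + \<delta>" "a t \<noteq> l - \<delta>" if "t \<ge> T" for t
    using T0[of t] that by (auto simp: T_def)
  have "eventually (\<lambda>n. \<tau> n \<ge> T) sequentially"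
    using \<tau> by (auto simp: filterlim_at_top)
  moreover have "eventually (\<lambda>n. dist (a (\<tau> n)) l < \<delta>) sequentially"
    using tendstoD[OF lim \<open>0 < \<delta>\<close>] .
  ultimately have "eventually (\<lambda>n. \<tau> n \<ge> T \<and> dist (a (\<tau> n)) l < \<delta>) sequentially"
    by (rule eventually_conj)
  then obtain s where s: "s \<ge> T" "\<bar>a s - l\<bar> < \<delta>"
    by (auto simp: dist_real_def dest!: eventually_happens)
  have conn: "connected (a ` {T..})"
    by (rule connected_continuous_image) (auto simp: T_def intro: continuous_on_subset[OF cont])
  have "\<bar>a t - l\<bar> < \<delta>" if t: "t \<ge> T" for t
  proof (rule ccontr)
    assume "\<not> ?thesis"
    then consider "a t \<ge> l + \<delta>" | "a t \<le> l - \<delta>" by linarith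
    then show False
    proof cases
      case 1
      have "l + \<delta> \<in> a ` {T..}"
        by (rule connectedD_interval[OF conn, of "a s" "a t"]) (use s t 1 in auto)
      then show False using avoid by (metis atLeast_iff imageE)
    next
      case 2
      have "l - \<delta> \<in> a ` {T..}"
        by (rule connectedD_interval[OF conn, of "a t" "a s"]) (use s t 2 in auto)
      then show False using avoid by (metis atLeast_iff imageE)
    qed
  qed
  then show "eventually (\<lambda>t. dist (a t) l < \<epsilon>) at_top"
    using \<delta> unfolding eventually_at_top_linorder
    by (intro exI[of _ T]) (auto simp: dist_real_def intro: less_trans)
qed

text \<open>The coordinates of a limit point are annihilated by the polynomial \<open>P\<close> with double zeros
  there, so the limit of the sum of the nonnegative \<open>P (a t e)\<close> is zero.\<close>

lemma tendsto_of_symmetric_poly_sums: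
  fixes a :: "real \<Rightarrow> 'e \<Rightarrow> real"
  assumes fin: "finite E" and cont: "\<And>e. e \<in> E \<Longrightarrow> continuous_on {0..} (\<lambda>t. a t e)"
    and bd: "\<And>e t. e \<in> E \<Longrightarrow> 0 \<le> t \<Longrightarrow> \<bar>a t e\<bar> \<le> M"
    and sums: "\<And>P. \<exists>L. ((\<lambda>t. \<Sum>e\<in>E. poly P (a t e)) \<longlongrightarrow> L) at_top"
  shows "\<exists>l. \<forall>e\<in>E. ((\<lambda>t. a t e) \<longlongrightarrow> l e) at_top"
proof -
  have "bounded (range (\<lambda>n. a (real n) e))" if "e \<in> E" for e
    using bd[OF that] by (auto intro!: boundedI[where B = M])
  from finite_family_convergent_subseq[OF fin this, of "\<lambda>e. e"] obtain s l where
    s: "strict_mono (s :: nat \<Rightarrow> nat)" "\<And>e. e \<in> E \<Longrightarrow> (\<lambda>n. a (real (s n)) e) \<longlonglongrightarrow> l e"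
    by blast
  have \<tau>: "filterlim (\<lambda>n. real (s n)) at_top sequentially"
    by (rule filterlim_compose[OF filterlim_real_sequentially filterlim_subseq[OF s(1)]])
  define P where "P = (\<Prod>c\<in>l ` E. [:- c, 1:] ^ 2)"
  have P0: "P \<noteq> 0" using fin by (simp add: P_def)
  have nonneg: "0 \<le> poly P x" for x by (auto simp: P_def poly_prod intro!: prod_nonneg)
  have root: "poly P (l e) = 0" if "e \<in> E" for e
    using fin that by (auto simp: P_def poly_prod)
  obtain L where L: "((\<lambda>t. \<Sum>e\<in>E. poly P (a t e)) \<longlongrightarrow> L) at_top"
    using sums by blast
  have "(\<lambda>n. \<Sum>e\<in>E. poly P (a (real (s n)) e)) \<longlonglongrightarrow> (\<Sum>e\<in>E. poly P (l e))"
    by (intro tendsto_sum tendsto_poly s)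
  moreover have "(\<lambda>n. \<Sum>e\<in>E. poly P (a (real (s n)) e)) \<longlonglongrightarrow> L"
    by (rule filterlim_compose[OF L \<tau>])
  ultimately have "L = (\<Sum>e\<in>E. poly P (l e))" by (rule LIMSEQ_unique[symmetric])
  then have L0: "L = 0" using root by simp
  have "((\<lambda>t. a t e) \<longlongrightarrow> l e) at_top" if e: "e \<in> E" for e
  proof (rule tendsto_of_poly_tendsto_0[OF cont[OF e] P0 _ \<tau> s(2)[OF e]])
    show "((\<lambda>t. poly P (a t e)) \<longlongrightarrow> 0) at_top"
    proof (rule tendsto_sandwich[OF _ _ tendsto_const L[unfolded L0]])
      show "eventually (\<lambda>t. poly P (a t e) \<le> (\<Sum>e\<in>E. poly P (a t e))) at_top"
        using fin e nonneg by (intro always_eventually allI member_le_sum) auto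
    qed (simp add: nonneg)
  qed
  then show ?thesis by blast
qed

section \<open>Ratios of two solutions\<close>

text \<open>Chebyshev's inequality: the probability vectors proportional to \<open>1 / a\<close> and \<open>1 / b\<close> have a
  likelihood ratio proportional to \<open>a / b\<close>.\<close>

lemma sum_inverse_weights_le:
  fixes a b \<theta> :: "'e \<Rightarrow> real"
  assumes fin: "finite S" and pos: "\<And>e. e \<in> S \<Longrightarrow> 0 < a e" "\<And>e. e \<in> S \<Longrightarrow> 0 < b e"
    and mono: "\<And>e f. e \<in> S \<Longrightarrow> f \<in> S \<Longrightarrow> b e / a e \<le> b f / a f \<Longrightarrow> \<theta> e \<le> \<theta> f"
  shows "(\<Sum>e\<in>S. \<theta> e * (1 / b e / (\<Sum>f\<in>S. 1 / b f) - 1 / a e / (\<Sum>f\<in>S. 1 / a f))) \<le> 0"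
proof (cases "S = {}")
  case False
  define A B where "A = (\<Sum>f\<in>S. 1 / a f)" and "B = (\<Sum>f\<in>S. 1 / b f)"
  have AB: "A > 0" "B > 0" unfolding A_def B_def using False fin pos by (auto intro!: sum_pos)
  \<comment> \<open>Summed over \<open>f\<close>, \<open>c e f\<close> is \<open>A * B\<close> times
    the difference of the two probabilities at \<open>e\<close>. It is antisymmetric and equals
    \<open>(b f / a f - b e / a e) / (b e * b f)\<close>, which is the consensus form with symmetric
    weights; hence the symmetrization of \<open>X\<close> below.\<close>
  define c where "c e f = 1 / (b e * a f) - 1 / (a e * b f)" for e f
  define X where "X = (\<Sum>e\<in>S. \<Sum>f\<in>S. \<theta> e * c e f)"
  have "X = (\<Sum>e\<in>S. \<Sum>f\<in>S. \<theta> f * c f e)" unfolding X_def by (rule sum.swap)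
  then have "X + X = (\<Sum>e\<in>S. \<Sum>f\<in>S. \<theta> e * c e f + \<theta> f * c f e)"
    by (simp add: X_def sum.distrib)
  also have "\<dots> = (\<Sum>e\<in>S. \<Sum>f\<in>S. (\<theta> e - \<theta> f) * c e f)"
  proof (intro sum.cong refl)
    fix e f
    have "c f e = - c e f" by (simp add: c_def mult.commute)
    then show "\<theta> e * c e f + \<theta> f * c f e = (\<theta> e - \<theta> f) * c e f" by (simp add: left_diff_distrib)
  qed
  also have "\<dots> \<le> 0"
  proof (intro sum_nonpos)
    fix e f assume ef: "e \<in> S" "f \<in> S"
    have c: "c e f = (a e * b f - b e * a f) / (a e * a f * b e * b f)"
      using pos[OF ef(1)] pos(1)[OF ef(2)] pos(2)[OF ef(2)] pos(2)[OF ef(1)]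
      by (simp add: c_def field_simps)
    have den: "0 < a e * a f * b e * b f" using pos ef by simp
    show "(\<theta> e - \<theta> f) * c e f \<le> 0"
    proof (cases "b e / a e \<le> b f / a f")
      case True
      then have "c e f \<ge> 0" using pos ef den by (simp add: c field_simps)
      then show ?thesis using mono[OF ef True] by (intro mult_nonpos_nonneg) auto
    next
      case False
      then have "c e f \<le> 0" using pos ef den unfolding c
        by (intro divide_nonpos_pos) (simp_all add: field_simps)
      then show ?thesis using mono[OF ef(2,1)] False by (intro mult_nonneg_nonpos) auto
    qed
  qed
  finally have "X \<le> 0" by simp
  have "\<theta> e * (1 / b e / B - 1 / a e / A) = (\<Sum>f\<in>S. \<theta> e * c e f) / (A * B)" if "e \<in> S" for e
  proof -
    have "(\<Sum>f\<in>S. \<theta> e * c e f) = \<theta> e * (A / b e - B / a e)"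
      by (simp add: c_def A_def B_def sum_distrib_left[symmetric] sum_subtractf sum_divide_distrib mult.commute)
    then show ?thesis using AB pos[OF that] by (simp add: right_diff_distrib diff_divide_distrib)
  qed
  then have "(\<Sum>e\<in>S. \<theta> e * (1 / b e / B - 1 / a e / A)) = X / (A * B)"
    by (simp add: X_def sum_divide_distrib)
  then show ?thesis using \<open>X \<le> 0\<close> AB by (simp add: A_def B_def divide_le_0_iff)
qed simp

section \<open>The vector field of the flow and positivity of solutions\<close>

definition flow_field :: "'v set set \<Rightarrow> ('v set \<Rightarrow> real) \<Rightarrow> 'v set \<Rightarrow> real" where
  "flow_field E w e =
     (\<Sum>x\<in>e. (real (card {e \<in> E. x \<in> e}) - 2) / inv_weight_degree E w x)"

context weighted_tree
begin

lemma curvature_eq_flow_field: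
  assumes e: "{x, y} \<in> E"
  shows "- lly_curvature V E w x y * w {x, y} = flow_field E w {x, y}"
proof -
  define a b where "a = real (card {e \<in> E. x \<in> e})" and "b = real (card {e \<in> E. y \<in> e})"
  have "- lly_curvature V E w x y * w {x, y} = - ((2 - a) / D x + (2 - b) / D y)"
    using w_pos[OF e] unfolding lly_curvature_tree[OF e] a_def[symmetric] b_def[symmetric] by simp
  also have "\<dots> = (a - 2) / D x + (b - 2) / D y"
    by (simp add: diff_divide_distrib)
  also have "\<dots> = flow_field E w {x, y}"
    using edgeD[OF e] by (simp add: flow_field_def a_def b_def)
  finally show ?thesis .
qed

text \<open>Each of the two endpoints \<open>z\<close> contributes at least \<open>- w e\<close>:
  its degree is at least one, and \<open>1 / w e\<close> is one of the positive summands of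
  \<open>D z\<close>.\<close>

lemma flow_field_ge:
  assumes e: "e \<in> E"
  shows "- 2 * w e \<le> flow_field E w e"
proof -
  obtain x y where xy: "e = {x, y}" "x \<noteq> y" by (rule edgeE[OF e])
  have "- w e \<le> (real (card {e \<in> E. z \<in> e}) - 2) / D z" if z: "z \<in> e" for z
  proof -
    have "1 / w e \<le> D z" unfolding inv_weight_degree_def
      by (rule member_le_sum) (use z e finite_E w_pos in \<open>auto intro: less_imp_le\<close>)
    moreover from this have "0 < D z" using w_pos[OF e] by (simp add: less_le_trans[of 0 "1 / w e"])
    ultimately have D: "0 < D z" "1 / D z \<le> w e" using w_pos[OF e] by (simp_all add: field_simps)
    have "card {e \<in> E. z \<in> e} > 0" using e z finite_E by (auto simp: card_gt_0_iff)
    then have "-1 / D z \<le> (real (card {e \<in> E. z \<in> e}) - 2) / D z"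
      using D(1) by (intro divide_right_mono) auto
    then show ?thesis using D by simp
  qed
  from this[of x] this[of y] xy show ?thesis by (simp add: flow_field_def)
qed

end

locale tree_flow =
  fixes V :: "'v set" and E :: "'v set set" and w :: "real \<Rightarrow> 'v set \<Rightarrow> real"
  assumes tree: "finite_tree V E" and flow: "ricci_flow_solution V E w"
begin

text \<open>The constant metric gives access to the purely combinatorial facts about the tree at
  times where positivity of \<open>w t\<close> is not yet known.\<close>

sublocale unit: weighted_tree V E "\<lambda>_. 1"
  by standard (simp_all add: tree positive_metric_def)

lemma continuous_flow:
  assumes "e \<in> E" shows "continuous_on {0..} (\<lambda>t. w t e)"
proof -
  obtain x y where e: "e = {x, y}" by (rule unit.edgeE[OF assms])
  show ?thesis
    using flow assms unfolding ricci_flow_solution_def e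
    by (intro DERIV_continuous_on) blast
qed

lemma flow_deriv_of_positive:
  assumes "e \<in> E" "0 < t" "positive_metric E (w t)"
  shows "((\<lambda>s. w s e) has_real_derivative flow_field E (w t) e) (at t)"
proof -
  interpret weighted_tree V E "w t" by standard (simp_all add: tree assms)
  obtain x y where e: "e = {x, y}" by (rule edgeE[OF assms(1)])
  have "((\<lambda>s. w s e) has_real_derivative flow_field E (w t) e) (at t within {0..})"
    using flow assms e curvature_eq_flow_field[of x y]
    by (simp only: ricci_flow_solution_def less_imp_le flip: curvature_eq_flow_field)
  moreover have "at t within {0..} = at t"
    using assms by (intro at_within_interior) simp
  ultimately show ?thesis by simp
qed

text \<open>At the first zero of some coordinate the bound \<open>w' \<ge> - 2 w\<close>, valid before, is violated.\<close>

lemma flow_positive: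
  assumes "0 \<le> t" shows "positive_metric E (w t)"
proof (rule ccontr)
  assume neg: "\<not> positive_metric E (w t)"
  define Z where "Z = (\<Union>e\<in>E. {0..} \<inter> (\<lambda>t. w t e) -` {..0})"
  have Z: "s \<in> Z \<longleftrightarrow> 0 \<le> s \<and> \<not> positive_metric E (w s)" for s
    by (auto simp: Z_def positive_metric_def not_less)
  have "closed Z" unfolding Z_def
    using unit.finite_E by (intro closed_UN ballI continuous_closed_preimage continuous_flow) auto
  moreover have "Z \<noteq> {}" "bdd_below Z" using Z neg assms by (auto intro!: bdd_belowI[of _ 0])
  ultimately have "Inf Z \<in> Z" by (intro closed_contains_Inf)
  define T where "T = Inf Z"
  have T: "0 \<le> T" "T \<in> Z" using \<open>Inf Z \<in> Z\<close> Z by (auto simp: T_def)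
  have before: "positive_metric E (w s)" if "0 \<le> s" "s < T" for s
    using that cInf_lower[OF _ \<open>bdd_below Z\<close>, of s] Z[of s] by (auto simp: T_def)
  obtain e where e: "e \<in> E" "w T e \<le> 0" using T Z by (auto simp: positive_metric_def not_less)
  \<comment> \<open>The integrating factor turns \<open>w' \<ge> - 2 w\<close> into monotonicity.
    The bound is available only strictly before \<open>T\<close>, so continuity carries the
    inequality to the endpoint.\<close>
  have "exp (2 * 0) * w 0 e \<le> exp (2 * T) * w T e"
  proof (rule DERIV_nonneg_imp_increasing_open[where f = "\<lambda>s. exp (2 * s) * w s e", OF T(1)])
    fix s assume s: "0 < s" "s < T"
    interpret weighted_tree V E "w s" by standard (use tree before s in auto)
    have "((\<lambda>s. exp (2 * s) * w s e) has_real_derivative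
      exp (2 * s) * (2 * w s e + flow_field E (w s) e)) (at s)"
      using e s before by (auto intro!: derivative_eq_intros flow_deriv_of_positive simp: algebra_simps)
    moreover have "0 \<le> exp (2 * s) * (2 * w s e + flow_field E (w s) e)"
      using flow_field_ge[OF e(1)] by simp
    ultimately show "\<exists>y. ((\<lambda>s. exp (2 * s) * w s e) has_real_derivative y) (at s) \<and> 0 \<le> y"
      by blast
  next
    show "continuous_on {0..T} (\<lambda>s. exp (2 * s) * w s e)"
      by (intro continuous_intros continuous_on_subset[OF continuous_flow[OF e(1)]]) auto
  qed
  moreover have "0 < w 0 e" using flow e by (auto simp: ricci_flow_solution_def positive_metric_def)
  ultimately have "0 < exp (2 * T) * w T e" by simp
  with e show False by (simp add: zero_less_mult_iff)
qed

lemma flow_pos: "0 \<le> t \<Longrightarrow> e \<in> E \<Longrightarrow> 0 < w t e"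
  using flow_positive by (auto simp: positive_metric_def)

lemma flow_deriv:
  "e \<in> E \<Longrightarrow> 0 < t \<Longrightarrow> ((\<lambda>s. w s e) has_real_derivative flow_field E (w t) e) (at t)"
  by (intro flow_deriv_of_positive flow_positive) auto

end

section \<open>Consensus dynamics and convergence of the ratios\<close>

locale tree_flow_pair = w: tree_flow V E w + v: tree_flow V E v
  for V :: "'v set" and E :: "'v set set" and w v :: "real \<Rightarrow> 'v set \<Rightarrow> real"
begin

abbreviation ratio :: "real \<Rightarrow> 'v set \<Rightarrow> real" where "ratio t e \<equiv> v t e / w t e"

lemma ratio_pos: "0 \<le> t \<Longrightarrow> e \<in> E \<Longrightarrow> 0 < ratio t e"
  using w.flow_pos v.flow_pos by simp

lemma continuous_ratio: "e \<in> E \<Longrightarrow> continuous_on {0..} (\<lambda>t. ratio t e)"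
  using w.flow_pos by (intro continuous_intros w.continuous_flow v.continuous_flow) (auto simp: less_le)

text \<open>The logarithmic derivative of the ratio is the difference of those of \<open>v\<close>
  and \<open>w\<close>. The bracket at \<open>x\<close> compares the probabilities with which the
  two random walks at \<open>x\<close> choose \<open>e\<close>, the form treated by
  \<open>sum_inverse_weights_le\<close>.\<close>

lemma ratio_deriv:
  assumes "e \<in> E" "0 < t"
  shows "((\<lambda>s. ratio s e) has_real_derivative ratio t e *
    (\<Sum>x\<in>e. (real (card {e \<in> E. x \<in> e}) - 2) *
      (1 / v t e / inv_weight_degree E (v t) x - 1 / w t e / inv_weight_degree E (w t) x))) (at t)"
proof -
  have p: "w t e > 0" "v t e > 0" using assms w.flow_pos v.flow_pos by simp_all
  have "((\<lambda>s. ratio s e) has_real_derivative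
    (flow_field E (v t) e * w t e - v t e * flow_field E (w t) e) / (w t e * w t e)) (at t)"
    using assms p by (intro DERIV_divide w.flow_deriv v.flow_deriv) auto
  also have "(flow_field E (v t) e * w t e - v t e * flow_field E (w t) e) / (w t e * w t e)
     = ratio t e * (flow_field E (v t) e / v t e - flow_field E (w t) e / w t e)"
    using p by (simp add: field_simps)
  also have "flow_field E (v t) e / v t e - flow_field E (w t) e / w t e =
    (\<Sum>x\<in>e. (real (card {e \<in> E. x \<in> e}) - 2) *
      (1 / v t e / inv_weight_degree E (v t) x - 1 / w t e / inv_weight_degree E (w t) x))"
    unfolding flow_field_def sum_divide_distrib sum_subtractf[symmetric]
    by (intro sum.cong refl) (simp only: right_diff_distrib, simp add: mult.commute)
  finally show ?thesis .
qed

text \<open>At a vertex of degree one both solutions have the same transition probability \<open>1\<close>, so the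
  negative factor \<open>d\<^sub>x - 2\<close> is harmless.\<close>

lemma sum_ratio_nonincreasing:
  assumes deriv: "\<And>z. 0 < z \<Longrightarrow> (\<psi> has_real_derivative \<psi>' z) (at z)"
    and mono: "\<And>t e f. 0 \<le> t \<Longrightarrow> e \<in> E \<Longrightarrow> f \<in> E \<Longrightarrow> ratio t e \<le> ratio t f \<Longrightarrow>
      ratio t e * \<psi>' (ratio t e) \<le> ratio t f * \<psi>' (ratio t f)"
    and st: "0 \<le> s" "s \<le> t"
  shows "(\<Sum>e\<in>E. \<psi> (ratio t e)) \<le> (\<Sum>e\<in>E. \<psi> (ratio s e))"
proof (rule DERIV_nonpos_imp_decreasing_open[OF st(2)])
  fix u assume "s < u" "u < t"
  then have u: "0 < u" using st by simp
  \<comment> \<open>The derivative of \<open>\<psi>\<close> with respect to the logarithm of the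
    ratio.\<close>
  define \<theta> where "\<theta> e = ratio u e * \<psi>' (ratio u e)" for e
  define c where "c x e = (real (card {e \<in> E. x \<in> e}) - 2) *
      (1 / v u e / inv_weight_degree E (v u) x - 1 / w u e / inv_weight_degree E (w u) x)" for x e
  have "((\<lambda>u. \<Sum>e\<in>E. \<psi> (ratio u e)) has_real_derivative
      (\<Sum>e\<in>E. \<psi>' (ratio u e) * (ratio u e * (\<Sum>x\<in>e. c x e)))) (at u)"
    unfolding c_def using u
    by (intro DERIV_sum DERIV_chain2[OF deriv] ratio_deriv ratio_pos) auto
  moreover have "(\<Sum>e\<in>E. \<psi>' (ratio u e) * (ratio u e * (\<Sum>x\<in>e. c x e))) \<le> 0"
  proof -
    have "(\<Sum>e\<in>E. \<psi>' (ratio u e) * (ratio u e * (\<Sum>x\<in>e. c x e))) =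
      (\<Sum>e\<in>E. \<Sum>x | x \<in> V \<and> x \<in> e. \<theta> e * c x e)"
    proof (intro sum.cong refl)
      fix e assume "e \<in> E"
      then have "e = {x. x \<in> V \<and> x \<in> e}" by (rule w.unit.edgeE) auto
      then show "\<psi>' (ratio u e) * (ratio u e * (\<Sum>x\<in>e. c x e)) = (\<Sum>x | x \<in> V \<and> x \<in> e. \<theta> e * c x e)"
        by (simp add: \<theta>_def sum_distrib_left mult.assoc mult.left_commute)
    qed
    \<comment> \<open>Regrouping by vertices: a sign is guaranteed only for all edges at one vertex
      taken together.\<close>
    also have "\<dots> = (\<Sum>x\<in>V. \<Sum>e | e \<in> E \<and> x \<in> e. \<theta> e * c x e)"
      by (rule sum.swap_restrict[OF w.unit.finite_E w.unit.finite_V])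
    also have "\<dots> \<le> 0"
    proof (rule sum_nonpos)
      fix x assume "x \<in> V"
      define S where "S = {e \<in> E. x \<in> e}"
      have fin: "finite S" using w.unit.finite_E by (simp add: S_def)
      have D: "inv_weight_degree E (v u) x = (\<Sum>f\<in>S. 1 / v u f)"
        "inv_weight_degree E (w u) x = (\<Sum>f\<in>S. 1 / w u f)"
        by (simp_all add: inv_weight_degree_def S_def)
      define b where "b = (\<Sum>e\<in>S. \<theta> e * (1 / v u e / (\<Sum>f\<in>S. 1 / v u f) - 1 / w u e / (\<Sum>f\<in>S. 1 / w u f)))"
      have eq: "(\<Sum>e | e \<in> E \<and> x \<in> e. \<theta> e * c x e) = (real (card S) - 2) * b"
        unfolding b_def c_def D sum_distrib_left S_def[symmetric]
        by (intro sum.cong refl) (simp add: mult.left_commute)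
      have "b \<le> 0" unfolding b_def
        by (rule sum_inverse_weights_le[OF fin])
          (use u w.flow_pos v.flow_pos mono[of u] in \<open>auto simp: S_def \<theta>_def\<close>)
      moreover have "b = 0" if "card S \<le> 1"
      proof -
        have "card S = 0 \<or> card S = 1" using that by linarith
        then show ?thesis
        proof
          assume "card S = 1"
          then obtain e where e: "S = {e}" by (rule card_1_singletonE)
          then have "w u e > 0" "v u e > 0"
            using w.flow_pos[of u e] v.flow_pos[of u e] u by (auto simp: S_def)
          then show ?thesis using e by (simp add: b_def)
        qed (simp add: b_def fin)
      qed
      ultimately show "(\<Sum>e | e \<in> E \<and> x \<in> e. \<theta> e * c x e) \<le> 0"
        unfolding eq by (cases "card S \<le> 1") (auto intro!: mult_nonneg_nonpos)
    qed
    finally show ?thesis .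
  qed
  ultimately show "\<exists>y. ((\<lambda>u. \<Sum>e\<in>E. \<psi> (ratio u e)) has_real_derivative y) (at u) \<and> y \<le> 0"
    by blast
next
  have "continuous_on {0<..} \<psi>"
    by (rule continuous_at_imp_continuous_on) (use deriv DERIV_isCont in blast)
  note cont = this
  show "continuous_on {s..t} (\<lambda>u. \<Sum>e\<in>E. \<psi> (ratio u e))"
  proof (rule continuous_on_sum)
    fix e assume e: "e \<in> E"
    have "(\<lambda>u. ratio u e) ` {s..t} \<subseteq> {0<..}"
      using ratio_pos[OF _ e] st by force
    moreover have "continuous_on {s..t} (\<lambda>u. ratio u e)"
      by (rule continuous_on_subset[OF continuous_ratio[OF e]]) (use st in auto)
    ultimately show "continuous_on {s..t} (\<lambda>u. \<psi> (ratio u e))"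
      using continuous_on_compose2[OF cont] by blast
  qed
qed

lemma ratio_bounds:
  obtains m M where "0 < m" "\<And>t e. 0 \<le> t \<Longrightarrow> e \<in> E \<Longrightarrow> m \<le> ratio t e \<and> ratio t e \<le> M"
proof -
  define M where "M = (\<Sum>e\<in>E. ratio 0 e)"
  \<comment> \<open>The summand 1 keeps \<open>K\<close> positive even if \<open>E\<close> is empty,
    which is possible for a tree with a single vertex.\<close>
  define K where "K = 1 + (\<Sum>e\<in>E. inverse (ratio 0 e))"
  have inv: "0 \<le> inverse (ratio t e)" if "0 \<le> t" "e \<in> E" for t e
    using ratio_pos[OF that] by (simp only: inverse_nonnegative_iff_nonnegative less_imp_le)
  have K: "K > 0" unfolding K_def by (intro add_pos_nonneg sum_nonneg inv) auto
  have "inverse K \<le> ratio t e \<and> ratio t e \<le> M" if t: "0 \<le> t" and e: "e \<in> E" for t e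
  proof
    have "ratio t e \<le> (\<Sum>e\<in>E. ratio t e)"
      using e w.unit.finite_E ratio_pos[OF t] by (intro member_le_sum) (auto intro: less_imp_le)
    also have "\<dots> \<le> M" unfolding M_def
      by (rule sum_ratio_nonincreasing[of "\<lambda>z. z" "\<lambda>_. 1"]) (use t in auto)
    finally show "ratio t e \<le> M" .
    have "inverse (ratio t e) \<le> (\<Sum>e\<in>E. inverse (ratio t e))"
      using e t w.unit.finite_E by (intro member_le_sum inv) auto
    also have "\<dots> \<le> (\<Sum>e\<in>E. inverse (ratio 0 e))"
    proof (rule sum_ratio_nonincreasing[of inverse "\<lambda>z. - (inverse z * inverse z)"])
      fix t e f assume *: "0 \<le> t" "e \<in> E" "f \<in> E" "ratio t e \<le> ratio t f"
      have "x * - (inverse x * inverse x) \<le> y * - (inverse y * inverse y)"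
        if "0 < x" "x \<le> y" for x y :: real
        using le_imp_inverse_le[of x y] that by (simp add: mult.assoc[symmetric])
      from this[OF ratio_pos *(4)] * show "ratio t e * - (inverse (ratio t e) * inverse (ratio t e))
        \<le> ratio t f * - (inverse (ratio t f) * inverse (ratio t f))" by blast
    qed (use t in \<open>auto intro!: derivative_eq_intros simp: power2_eq_square\<close>)
    also have "\<dots> \<le> K" by (simp add: K_def)
    finally have "inverse (ratio t e) \<le> K" .
    moreover have "0 < inverse (ratio t e)"
      using ratio_pos[OF t e] by (rule positive_imp_inverse_positive)
    ultimately have "inverse K \<le> inverse (inverse (ratio t e))" by (rule le_imp_inverse_le)
    then show "inverse K \<le> ratio t e" by (simp only: inverse_inverse_eq)
  qed
  with K that[of "inverse K" M] show ?thesis by simp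
qed

text \<open>For \<open>K\<close> large both \<open>K z\<close> and \<open>P z + K z\<close> satisfy the monotonicity hypothesis of
  \<open>sum_ratio_nonincreasing\<close>.\<close>

lemma sum_poly_ratio_tendsto: "\<exists>L. ((\<lambda>t. \<Sum>e\<in>E. poly P (ratio t e)) \<longlongrightarrow> L) at_top"
proof -
  obtain m M where m: "0 < m" and
    bounds: "\<And>t e. 0 \<le> t \<Longrightarrow> e \<in> E \<Longrightarrow> m \<le> ratio t e \<and> ratio t e \<le> M"
    by (rule ratio_bounds) blast
  have bdd: "\<exists>B>0. \<forall>z\<in>{m..M}. \<bar>poly Q z\<bar> \<le> B" for Q
  proof -
    have "bounded (poly Q ` {m..M})"
      by (intro compact_imp_bounded compact_continuous_image) (auto intro!: continuous_intros)
    then show ?thesis by (auto simp: bounded_pos)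
  qed
  \<comment> \<open>\<open>Q\<close> is \<open>z P'(z)\<close>. Adding \<open>K z\<close> to
    \<open>P\<close> adds \<open>K z\<close> to \<open>Q\<close> as well, and its slope
    \<open>K\<close> dominates the derivative of \<open>Q\<close> on the interval from
    \<open>m\<close> to \<open>M\<close>.\<close>
  define Q where "Q = [:0, 1:] * pderiv P"
  obtain K where K: "K > 0" "\<And>z. m \<le> z \<Longrightarrow> z \<le> M \<Longrightarrow> \<bar>poly (pderiv Q) z\<bar> \<le> K"
    using bdd[of "pderiv Q"] by auto
  obtain B where B: "\<And>z. m \<le> z \<Longrightarrow> z \<le> M \<Longrightarrow> \<bar>poly (P + [:0, K:]) z\<bar> \<le> B"
    using bdd[of "P + [:0, K:]"] by (metis atLeastAtMost_iff)
  have "\<exists>L. ((\<lambda>t. \<Sum>e\<in>E. poly (P + [:0, K:]) (ratio t e)) \<longlongrightarrow> L) at_top"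
  proof (rule nonincreasing_imp_tendsto_at_top)
    fix s t :: real assume st: "0 \<le> s" "s \<le> t"
    show "(\<Sum>e\<in>E. poly (P + [:0, K:]) (ratio t e)) \<le> (\<Sum>e\<in>E. poly (P + [:0, K:]) (ratio s e))"
    proof (rule sum_ratio_nonincreasing[OF poly_DERIV _ st])
      fix t e f assume *: "0 \<le> t" "e \<in> E" "f \<in> E" "ratio t e \<le> ratio t f"
      have eq: "z * poly (pderiv (P + [:0, K:])) z = poly (Q + [:0, K:]) z" for z
        by (simp add: Q_def pderiv_add pderiv_pCons algebra_simps)
      show "ratio t e * poly (pderiv (P + [:0, K:])) (ratio t e)
        \<le> ratio t f * poly (pderiv (P + [:0, K:])) (ratio t f)"
        unfolding eq
      proof (rule DERIV_nonneg_imp_nondecreasing[OF *(4)])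
        fix z assume "ratio t e \<le> z" "z \<le> ratio t f"
        with bounds[of t e] bounds[of t f] * have "m \<le> z" "z \<le> M" by auto
        then have "0 \<le> poly (pderiv (Q + [:0, K:])) z"
          using K(2)[of z] by (simp add: pderiv_add pderiv_pCons)
        then show "\<exists>y. (poly (Q + [:0, K:]) has_real_derivative y) (at z) \<and> 0 \<le> y"
          using poly_DERIV by blast
      qed
    qed
  next
    fix t :: real assume "0 \<le> t"
    then show "(\<Sum>e\<in>E. - B) \<le> (\<Sum>e\<in>E. poly (P + [:0, K:]) (ratio t e))"
      using bounds B by (intro sum_mono) (meson abs_le_D2 minus_le_iff)
  qed
  then obtain L1 where L1: "((\<lambda>t. \<Sum>e\<in>E. poly (P + [:0, K:]) (ratio t e)) \<longlongrightarrow> L1) at_top" ..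
  have "\<exists>L. ((\<lambda>t. \<Sum>e\<in>E. ratio t e) \<longlongrightarrow> L) at_top"
  proof (rule nonincreasing_imp_tendsto_at_top)
    fix s t :: real assume "0 \<le> s" "s \<le> t"
    then show "(\<Sum>e\<in>E. ratio t e) \<le> (\<Sum>e\<in>E. ratio s e)"
      by (intro sum_ratio_nonincreasing[of "\<lambda>z. z" "\<lambda>_. 1"]) auto
  next
    fix t :: real assume "0 \<le> t"
    then show "0 \<le> (\<Sum>e\<in>E. ratio t e)" using ratio_pos by (intro sum_nonneg less_imp_le) auto
  qed
  then obtain L2 where L2: "((\<lambda>t. \<Sum>e\<in>E. ratio t e) \<longlongrightarrow> L2) at_top" ..
  have "((\<lambda>t. (\<Sum>e\<in>E. poly (P + [:0, K:]) (ratio t e)) - K * (\<Sum>e\<in>E. ratio t e))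
      \<longlongrightarrow> L1 - K * L2) at_top"
    by (intro tendsto_intros L1 L2)
  moreover have "(\<Sum>e\<in>E. poly (P + [:0, K:]) (ratio t e)) - K * (\<Sum>e\<in>E. ratio t e) =
    (\<Sum>e\<in>E. poly P (ratio t e))" for t
    by (simp add: sum.distrib sum_distrib_left mult.commute)
  ultimately show ?thesis by auto
qed

lemma ratio_tendsto:
  obtains r where "\<forall>e\<in>E. ((\<lambda>t. ratio t e) \<longlongrightarrow> r e) at_top" "\<forall>e\<in>E. 0 < r e"
proof -
  obtain m M where m: "0 < m" and
    bounds: "\<And>t e. 0 \<le> t \<Longrightarrow> e \<in> E \<Longrightarrow> m \<le> ratio t e \<and> ratio t e \<le> M"
    by (rule ratio_bounds) blast
  have "\<exists>r. \<forall>e\<in>E. ((\<lambda>t. ratio t e) \<longlongrightarrow> r e) at_top"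
  proof (rule tendsto_of_symmetric_poly_sums[OF w.unit.finite_E continuous_ratio _ sum_poly_ratio_tendsto])
    fix e t assume "e \<in> E" "(0::real) \<le> t"
    with bounds[of t e] m show "\<bar>ratio t e\<bar> \<le> M" by auto
  qed
  then obtain r where r: "\<And>e. e \<in> E \<Longrightarrow> ((\<lambda>t. ratio t e) \<longlongrightarrow> r e) at_top" by blast
  have "0 < r e" if "e \<in> E" for e
  proof -
    have "m \<le> r e"
      using bounds that
      by (intro tendsto_lowerbound[OF r[OF that]] eventually_mono[OF eventually_ge_at_top[of 0]]) auto
    with m show ?thesis by simp
  qed
  with r that show ?thesis by blast
qed

end

section \<open>Rescaling of the simplex\<close>

lemma tendsto_fun_iff:
  fixes f :: "'a \<Rightarrow> 'b \<Rightarrow> 'c::topological_space"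
  shows "(f \<longlongrightarrow> l) F \<longleftrightarrow> (\<forall>x. ((\<lambda>t. f t x) \<longlongrightarrow> l x) F)"
  using limitin_componentwise[of "\<lambda>_. euclidean" UNIV f l F]
  by (simp add: euclidean_product_topology)

lemma normalize_metric_in_closed_simplex:
  assumes "finite E" "E \<noteq> {}" "positive_metric E w"
  shows "normalize_metric E w \<in> closed_simplex E"
proof -
  have "0 < sum w E" using assms by (intro sum_pos) (auto simp: positive_metric_def)
  moreover from this have "(\<Sum>e\<in>E. normalize_metric E w e) = 1"
    by (simp add: normalize_metric_def flip: sum_divide_distrib)
  ultimately show ?thesis using assms
    by (simp add: closed_simplex_def normalize_metric_def positive_metric_def less_imp_le)
qed

lemma closed_simplex_le_one:
  assumes "finite E" "p \<in> closed_simplex E" "e \<in> E"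
  shows "p e \<le> 1"
  using member_le_sum[of e E p] assms by (auto simp: closed_simplex_def)

lemma rescale_denominator_pos:
  assumes "finite E" "\<forall>e\<in>E. 0 < r e" "p \<in> closed_simplex E"
  shows "0 < (\<Sum>f\<in>E. r f * p f)"
proof -
  have p: "\<And>e. e \<in> E \<Longrightarrow> 0 \<le> p e" "sum p E = 1" using assms by (auto simp: closed_simplex_def)
  then obtain f where "f \<in> E" "p f \<noteq> 0" by (metis sum.neutral zero_neq_one)
  with p assms show ?thesis
    by (intro sum_pos2[of E f]) (auto simp: less_le intro!: mult_nonneg_nonneg)
qed

lemma rescale_in_closed_simplex:
  assumes "finite E" "\<forall>e\<in>E. 0 < r e" "p \<in> closed_simplex E"
  shows "rescale E r p \<in> closed_simplex E"
  using rescale_denominator_pos[OF assms] assms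
  by (auto simp: closed_simplex_def rescale_def less_imp_le sum_divide_distrib[symmetric]
      intro!: divide_nonneg_pos mult_nonneg_nonneg)

text \<open>The outer denominator is the reciprocal of the inner one, \<open>R\<close>, so both
  cancel. Relating \<open>s\<close> and \<open>r\<close> by a product lets the lemma serve both
  compositions.\<close>

lemma rescale_rescale_inverse:
  assumes "finite E" "\<forall>e\<in>E. 0 < r e" "p \<in> closed_simplex E"
    and "\<forall>e\<in>E. s e * r e = 1"
  shows "rescale E s (rescale E r p) = p"
proof
  fix e
  define R where "R = (\<Sum>f\<in>E. r f * p f)"
  have R: "R > 0" unfolding R_def by (rule rescale_denominator_pos) (use assms in auto)
  have s: "s f * (r f * p f / R) = p f / R" if "f \<in> E" for f
    using assms(4) that by (simp flip: mult.assoc)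
  then have "(\<Sum>f\<in>E. s f * (r f * p f / R)) = (\<Sum>f\<in>E. p f / R)"
    by (intro sum.cong refl)
  also have "\<dots> = 1 / R"
    using assms(3) by (simp add: closed_simplex_def flip: sum_divide_distrib)
  finally show "rescale E s (rescale E r p) e = p e"
    using R assms(3) s[of e] by (cases "e \<in> E") (simp_all add: rescale_def closed_simplex_def flip: R_def)
qed

lemma rescale_tendsto:
  assumes "finite E" "\<forall>e\<in>E. 0 < r e" "p \<in> closed_simplex E" and "(f \<longlongrightarrow> p) F"
  shows "((\<lambda>t. rescale E r (f t)) \<longlongrightarrow> rescale E r p) F"
proof -
  have "\<And>e. ((\<lambda>t. f t e) \<longlongrightarrow> p e) F" using assms(4) by (simp add: tendsto_fun_iff)
  moreover have "(\<Sum>f\<in>E. r f * p f) \<noteq> 0"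
    using rescale_denominator_pos[OF assms(1-3)] by simp
  ultimately show ?thesis
    unfolding tendsto_fun_iff rescale_def by (intro allI tendsto_intros)
qed

lemma homeomorphism_rescale:
  assumes E: "finite E" and r: "\<forall>e\<in>E. 0 < r e"
  shows "homeomorphism (closed_simplex E) (closed_simplex E)
    (rescale E r) (rescale E (\<lambda>e. inverse (r e)))"
proof -
  have cont: "continuous_on (closed_simplex E) (rescale E s)" if "\<forall>e\<in>E. 0 < s e" for s
    unfolding continuous_on_def
    using rescale_tendsto[OF E that _ tendsto_ident_at] by blast
  have inv: "\<forall>e\<in>E. 0 < inverse (r e)" "\<forall>e\<in>E. inverse (r e) * r e = 1" "\<forall>e\<in>E. r e * inverse (r e) = 1"
    using r by force+
  note left = rescale_rescale_inverse[where s = "\<lambda>e. inverse (r e)", OF E r _ inv(2)]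
  note right = rescale_rescale_inverse[where r = "\<lambda>e. inverse (r e)", OF E inv(1) _ inv(3)]
  note mem = rescale_in_closed_simplex[OF E r] rescale_in_closed_simplex[OF E inv(1)]
  show ?thesis
    by (rule homeomorphismI) (use cont[OF r] cont[OF inv(1)] mem left right in auto)
qed

text \<open>The convergence claims speak of arbitrary limits \<open>p\<close>; this places them in
  the simplex, where the denominator of \<open>rescale\<close> is positive and
  \<open>rescale_tendsto\<close> applies.\<close>

lemma tendsto_in_closed_simplex:
  assumes "F \<noteq> bot" "eventually (\<lambda>t. f t \<in> closed_simplex E) F" "(f \<longlongrightarrow> p) F"
  shows "p \<in> closed_simplex E"
proof -
  have lim: "((\<lambda>t. f t e) \<longlongrightarrow> p e) F" for e using assms(3) by (simp add: tendsto_fun_iff)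
  have "0 \<le> p e" if "e \<in> E" for e
    using assms(2) that
    by (intro tendsto_lowerbound[OF lim _ assms(1)]) (auto elim!: eventually_mono simp: closed_simplex_def)
  moreover have "p e = 0" if "e \<notin> E" for e
  proof (rule tendsto_unique[OF assms(1) lim])
    show "((\<lambda>t. f t e) \<longlongrightarrow> 0) F"
      using assms(2) that by (intro tendsto_eventually) (auto elim!: eventually_mono simp: closed_simplex_def)
  qed
  moreover have "sum p E = 1"
  proof (rule tendsto_unique[OF assms(1)])
    show "((\<lambda>t. \<Sum>e\<in>E. f t e) \<longlongrightarrow> sum p E) F" by (intro tendsto_sum lim)
    show "((\<lambda>t. \<Sum>e\<in>E. f t e) \<longlongrightarrow> 1) F"
      using assms(2) by (intro tendsto_eventually) (auto elim!: eventually_mono simp: closed_simplex_def)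
  qed
  ultimately show ?thesis by (simp add: closed_simplex_def)
qed

lemma positive_edges_rescale:
  assumes "finite E" "\<forall>e\<in>E. 0 < r e" "p \<in> closed_simplex E"
  shows "positive_edges E (rescale E r p) = positive_edges E p"
  using rescale_denominator_pos[OF assms] assms(2)
  by (auto simp: positive_edges_def rescale_def zero_less_divide_iff zero_less_mult_iff dest: less_asym)

section \<open>Comparison of the normalized flows\<close>

context tree_flow_pair
begin

text \<open>The limits enter as a hypothesis so that the results apply with \<open>r\<close> to the
  given pair and with the inverse of \<open>r\<close> to the swapped pair.\<close>

context
  fixes r :: "'v set \<Rightarrow> real"
  assumes nonempty: "E \<noteq> {}"
    and r: "\<forall>e\<in>E. ((\<lambda>t. ratio t e) \<longlongrightarrow> r e) at_top" and r_pos: "\<forall>e\<in>E. 0 < r e"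
begin

abbreviation wn where "wn t \<equiv> normalize_metric E (w t)"
abbreviation vn where "vn t \<equiv> normalize_metric E (v t)"

lemma normalized_in_closed_simplex:
  assumes "0 \<le> t"
  shows "wn t \<in> closed_simplex E" "vn t \<in> closed_simplex E"
  using assms nonempty w.unit.finite_E w.flow_positive v.flow_positive
  by (auto intro!: normalize_metric_in_closed_simplex)

text \<open>The totals cancel, so \<open>vn t\<close> is the rescaling of \<open>wn t\<close> by the
  ratios at time \<open>t\<close>. What remains is to replace these ratios by their limits.\<close>

lemma vn_eq:
  assumes t: "0 \<le> t" and e: "e \<in> E"
  shows "vn t e = ratio t e * wn t e / (\<Sum>f\<in>E. ratio t f * wn t f)"
proof -
  have W: "0 < sum (w t) E"
    using nonempty w.unit.finite_E w.flow_pos[OF t] by (intro sum_pos) auto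
  have rw: "ratio t f * wn t f = v t f / sum (w t) E" if "f \<in> E" for f
    using w.flow_pos[OF t that] that by (simp add: normalize_metric_def)
  have "(\<Sum>f\<in>E. ratio t f * wn t f) = (\<Sum>f\<in>E. v t f / sum (w t) E)"
    by (intro sum.cong refl rw)
  also have "\<dots> = sum (v t) E / sum (w t) E" by (simp add: sum_divide_distrib)
  finally show ?thesis
    using W e unfolding rw[OF e] by (simp add: normalize_metric_def)
qed

text \<open>With \<open>S = (\<Sum>f\<in>E. ratio t f * wn t f)\<close> and \<open>R = (\<Sum>f\<in>E. r f * wn t f)\<close> the difference is
  \<open>(ratio t e - r e) * wn t e / R - vn t e * (S - R) / R\<close>, and \<open>R\<close> is at least \<open>min r\<close>.\<close>

lemma normalized_diff_tendsto: "((\<lambda>t. vn t e - rescale E r (wn t) e) \<longlongrightarrow> 0) at_top"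
proof (cases "e \<in> E")
  case e: True
  \<comment> \<open>Convergence of \<open>wn\<close> is not assumed, so the denominator needs a
    lower bound that is uniform over the simplex.\<close>
  define m where "m = Min (r ` E)"
  have m: "0 < m" "\<And>f. f \<in> E \<Longrightarrow> m \<le> r f"
    using nonempty w.unit.finite_E r_pos by (auto simp: m_def)
  define D where "D t = (\<Sum>f\<in>E. \<bar>ratio t f - r f\<bar>)" for t
  have D: "(D \<longlongrightarrow> (\<Sum>f\<in>E. \<bar>r f - r f\<bar>)) at_top"
    unfolding D_def by (intro tendsto_intros r[rule_format])
  have lim: "((\<lambda>t. (\<bar>ratio t e - r e\<bar> + D t) / m) \<longlongrightarrow> (\<bar>r e - r e\<bar> + (\<Sum>f\<in>E. \<bar>r f - r f\<bar>)) / m) at_top"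
    using m(1) by (intro tendsto_intros r[rule_format] e D) auto
  have bound: "\<bar>vn t e - rescale E r (wn t) e\<bar> \<le> (\<bar>ratio t e - r e\<bar> + D t) / m" if t: "0 \<le> t" for t
  proof -
    note simplex = normalized_in_closed_simplex[OF t]
    have wn: "0 \<le> wn t f" "wn t f \<le> 1" if "f \<in> E" for f
      using simplex(1) closed_simplex_le_one[OF w.unit.finite_E simplex(1) that] that
      by (auto simp: closed_simplex_def)
    have vn: "0 \<le> vn t e" "vn t e \<le> 1"
      using simplex(2) closed_simplex_le_one[OF w.unit.finite_E simplex(2) e] e
      by (auto simp: closed_simplex_def)
    define S where "S = (\<Sum>f\<in>E. ratio t f * wn t f)"
    define R where "R = (\<Sum>f\<in>E. r f * wn t f)"
    have S: "0 < S" unfolding S_def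
      using simplex(1) ratio_pos[OF t] by (intro rescale_denominator_pos w.unit.finite_E ballI)
    have "m = (\<Sum>f\<in>E. m * wn t f)"
      using simplex(1) by (simp add: closed_simplex_def flip: sum_distrib_left)
    also have "\<dots> \<le> R" unfolding R_def by (intro sum_mono mult_right_mono m wn)
    finally have R: "m \<le> R" .
    then have R0: "0 < R" using m by simp
    have "\<bar>S - R\<bar> = \<bar>\<Sum>f\<in>E. (ratio t f - r f) * wn t f\<bar>"
      by (simp only: S_def R_def left_diff_distrib sum_subtractf)
    also have "\<dots> \<le> D t" unfolding D_def
    proof (rule order_trans[OF sum_abs sum_mono])
      fix f assume "f \<in> E"
      then show "\<bar>(ratio t f - r f) * wn t f\<bar> \<le> \<bar>ratio t f - r f\<bar>"
        using wn[of f] by (simp add: abs_mult mult_left_le)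
    qed
    finally have SR: "\<bar>S - R\<bar> \<le> D t" .
    have "vn t e = ratio t e * wn t e / S" using vn_eq[OF t e] by (simp only: S_def)
    then have "vn t e * S = ratio t e * wn t e" using S by simp
    then have "vn t e - rescale E r (wn t) e = ((ratio t e - r e) * wn t e - vn t e * (S - R)) / R"
      using R0 by (simp only: rescale_def flip: R_def) (simp add: field_simps)
    also have "\<bar>\<dots>\<bar> \<le> (\<bar>ratio t e - r e\<bar> + D t) / m"
    proof -
      have "\<bar>(ratio t e - r e) * wn t e\<bar> \<le> \<bar>ratio t e - r e\<bar>"
        using wn[OF e] by (simp add: abs_mult mult_left_le)
      moreover have "\<bar>vn t e * (S - R)\<bar> \<le> D t"
        using vn SR mult_mono[of "vn t e" 1 "\<bar>S - R\<bar>" "D t"] by (simp add: abs_mult)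
      ultimately have "\<bar>(ratio t e - r e) * wn t e - vn t e * (S - R)\<bar> \<le> \<bar>ratio t e - r e\<bar> + D t"
        by linarith
      then have "\<bar>(ratio t e - r e) * wn t e - vn t e * (S - R)\<bar> / R \<le> (\<bar>ratio t e - r e\<bar> + D t) / m"
        using R m by (intro frac_le) auto
      then show ?thesis using R0 by simp
    qed
    finally show ?thesis .
  qed
  show ?thesis
  proof (rule Lim_null_comparison)
    show "eventually (\<lambda>t. norm (vn t e - rescale E r (wn t) e) \<le> (\<bar>ratio t e - r e\<bar> + D t) / m) at_top"
      using bound by (intro eventually_mono[OF eventually_ge_at_top[of 0]]) (simp only: real_norm_def)
    show "((\<lambda>t. (\<bar>ratio t e - r e\<bar> + D t) / m) \<longlongrightarrow> 0) at_top"
      using lim by simp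
  qed
next
  case False
  then have "vn t e - rescale E r (wn t) e = 0" for t
    by (simp add: normalize_metric_def rescale_def)
  then show ?thesis by simp
qed

text \<open>The general filter covers both uses: sequences of times for omega-limit points and the
  identity along \<open>at_top\<close> for convergence.\<close>

lemma normalized_transfer:
  assumes "filterlim \<tau> at_top F" "((\<lambda>j. wn (\<tau> j)) \<longlongrightarrow> p) F" "p \<in> closed_simplex E"
  shows "((\<lambda>j. vn (\<tau> j)) \<longlongrightarrow> rescale E r p) F"
  unfolding tendsto_fun_iff
proof
  fix e
  have "((\<lambda>j. vn (\<tau> j) e - rescale E r (wn (\<tau> j)) e) \<longlongrightarrow> 0) F"
    by (rule filterlim_compose[OF normalized_diff_tendsto assms(1)])
  moreover have "((\<lambda>j. rescale E r (wn (\<tau> j)) e) \<longlongrightarrow> rescale E r p e) F"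
    using rescale_tendsto[OF w.unit.finite_E r_pos assms(3,2)] by (simp add: tendsto_fun_iff)
  ultimately have "((\<lambda>j. (vn (\<tau> j) e - rescale E r (wn (\<tau> j)) e) + rescale E r (wn (\<tau> j)) e)
      \<longlongrightarrow> 0 + rescale E r p e) F"
    by (rule tendsto_add)
  then show "((\<lambda>j. vn (\<tau> j) e) \<longlongrightarrow> rescale E r p e) F" by simp
qed

lemma normalized_omega_limit:
  "p \<in> omega_limit_set E wn \<Longrightarrow> rescale E r p \<in> omega_limit_set E vn"
  using normalized_transfer rescale_in_closed_simplex[OF w.unit.finite_E r_pos]
  by (fastforce simp: omega_limit_set_def)

lemma normalized_tendsto:
  assumes "(wn \<longlongrightarrow> p) at_top"
  shows "(vn \<longlongrightarrow> rescale E r p) at_top"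
proof (rule normalized_transfer[OF filterlim_ident assms])
  show "p \<in> closed_simplex E"
    using normalized_in_closed_simplex(1)
    by (intro tendsto_in_closed_simplex[OF _ _ assms] eventually_mono[OF eventually_ge_at_top[of 0]]) auto
qed

end

end

theorem theorem1p9:
  fixes V :: "'v set" and E :: "'v set set"
    and w\<^sub>0 v\<^sub>0 w v :: "real \<Rightarrow> 'v set \<Rightarrow> real"
  assumes "finite_tree V E" and "E \<noteq> {}"
    and "ricci_flow_solution V E w\<^sub>0" and "ricci_flow_solution V E v\<^sub>0"
    and "w = (\<lambda>t. normalize_metric E (w\<^sub>0 t))" and "v = (\<lambda>t. normalize_metric E (v\<^sub>0 t))"
  shows "let r = (\<lambda>e. Lim at_top (\<lambda>t. v\<^sub>0 t e / w\<^sub>0 t e)) in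
    (\<forall>e\<in>E. ((\<lambda>t. v\<^sub>0 t e / w\<^sub>0 t e) \<longlongrightarrow> r e) at_top \<and> 0 < r e) \<and>
    ((\<lambda>t. L2_set (\<lambda>e. v t e - rescale E r (w t) e) E) \<longlongrightarrow> 0) at_top \<and>
    omega_limit_set E v = rescale E r ` omega_limit_set E w \<and>
    homeomorphism (closed_simplex E) (closed_simplex E)
      (rescale E r) (rescale E (\<lambda>e. inverse (r e))) \<and>
    {positive_edges E p | p. p \<in> omega_limit_set E w} =
      {positive_edges E q | q. q \<in> omega_limit_set E v} \<and>
    ((\<exists>p. (w \<longlongrightarrow> p) at_top) \<longleftrightarrow> (\<exists>q. (v \<longlongrightarrow> q) at_top)) \<and>
    (\<forall>p. (w \<longlongrightarrow> p) at_top \<longrightarrow> (v \<longlongrightarrow> rescale E r p) at_top)"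
proof -
  interpret wv: tree_flow_pair V E w\<^sub>0 v\<^sub>0 by standard (use assms in auto)
  \<comment> \<open>Exchanging the two solutions inverts the limits of the ratios; this yields the
    reverse inclusion of omega-limit sets and the reverse implication between convergences.\<close>
  interpret vw: tree_flow_pair V E v\<^sub>0 w\<^sub>0 by standard
  define r where "r = (\<lambda>e. Lim at_top (\<lambda>t. v\<^sub>0 t e / w\<^sub>0 t e))"
  obtain r' where r': "\<forall>e\<in>E. ((\<lambda>t. v\<^sub>0 t e / w\<^sub>0 t e) \<longlongrightarrow> r' e) at_top"
    "\<forall>e\<in>E. 0 < r' e"
    by (rule wv.ratio_tendsto) blast
  \<comment> \<open>Only the values on \<open>E\<close> are identified: points of the simplex vanish
    off \<open>E\<close>, and so do their rescalings.\<close>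
  have eq: "\<forall>e\<in>E. r e = r' e"
    unfolding r_def using tendsto_Lim[OF trivial_limit_at_top_linorder] r'(1) by blast
  with r' have r: "\<forall>e\<in>E. ((\<lambda>t. v\<^sub>0 t e / w\<^sub>0 t e) \<longlongrightarrow> r e) at_top" "\<forall>e\<in>E. 0 < r e"
    by simp_all
  have "((\<lambda>t. inverse (v\<^sub>0 t e / w\<^sub>0 t e)) \<longlongrightarrow> inverse (r e)) at_top" if "e \<in> E" for e
    using r that by (intro tendsto_inverse) auto
  then have inv: "\<forall>e\<in>E. ((\<lambda>t. w\<^sub>0 t e / v\<^sub>0 t e) \<longlongrightarrow> inverse (r e)) at_top"
    "\<forall>e\<in>E. 0 < inverse (r e)" "\<forall>e\<in>E. r e * inverse (r e) = 1"
    using r by (simp, simp, force)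
  note fin = wv.w.unit.finite_E
  note to_v = wv.normalized_omega_limit[OF assms(2) r, folded assms(5,6)]
  note to_w = vw.normalized_omega_limit[OF assms(2) inv(1,2), folded assms(5,6)]
  have simplex: "p \<in> closed_simplex E" if "p \<in> omega_limit_set E x" for p x
    using that by (simp add: omega_limit_set_def)
  have omega: "omega_limit_set E v = rescale E r ` omega_limit_set E w"
  proof (intro equalityI subsetI)
    fix q assume q: "q \<in> omega_limit_set E v"
    have "q = rescale E r (rescale E (\<lambda>e. inverse (r e)) q)"
      using rescale_rescale_inverse[OF fin inv(2) simplex[OF q] inv(3)] by simp
    with to_w[OF q] show "q \<in> rescale E r ` omega_limit_set E w" by blast
  qed (use to_v in auto)
  have "((\<lambda>t. L2_set (\<lambda>e. v t e - rescale E r (w t) e) E) \<longlongrightarrow> sqrt (\<Sum>e\<in>E. 0 ^ 2)) at_top"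
    unfolding L2_set_def assms(5,6)
    by (intro tendsto_intros wv.normalized_diff_tendsto[OF assms(2) r])
  then have L2: "((\<lambda>t. L2_set (\<lambda>e. v t e - rescale E r (w t) e) E) \<longlongrightarrow> 0) at_top" by simp
  have edges: "{positive_edges E p | p. p \<in> omega_limit_set E w} =
      {positive_edges E q | q. q \<in> omega_limit_set E v}"
    unfolding omega setcompr_eq_image Collect_mem_eq image_image
    using positive_edges_rescale[OF fin r(2) simplex] by (intro image_cong refl) simp
  have conv: "(w \<longlongrightarrow> p) at_top \<Longrightarrow> (v \<longlongrightarrow> rescale E r p) at_top" for p
    by (rule wv.normalized_tendsto[OF assms(2) r, folded assms(5,6)])
  moreover have "(v \<longlongrightarrow> q) at_top \<Longrightarrow> (w \<longlongrightarrow> rescale E (\<lambda>e. inverse (r e)) q) at_top" for q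
    by (rule vw.normalized_tendsto[OF assms(2) inv(1,2), folded assms(5,6)])
  ultimately have "(\<exists>p. (w \<longlongrightarrow> p) at_top) \<longleftrightarrow> (\<exists>q. (v \<longlongrightarrow> q) at_top)" by blast
  with r omega L2 edges conv homeomorphism_rescale[OF fin r(2)] show ?thesis
    unfolding Let_def r_def[symmetric] by blast
qed

end
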